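(* Let $\varphi$ be a smooth complex-valued solution on $dS_4$ of the equation $\Box\varphi-2\varphi=0$. Then for every $\omega\in S^3$ the limits defining the boundary data $\phi|_{\mathcal I^\pm}(\omega)$ and $\pi|_{\mathcal I^\pm}(\omega)$ exist. The solution space is the direct sum of the antipodally even solutions ($\varphi(-x)=\varphi(x)$) and the antipodally odd solutions ($\varphi(-x)=-\varphi(x)$), and: (1) if $\varphi$ is antipodally even, then $\phi\equiv0$ on both $\mathcal I^+$ and $\mathcal I^-$ (vanishing Dirichlet data); (2) if $\varphi$ is antipodally odd, then $\pi\equiv0$ on both $\mathcal I^+$ and $\mathcal I^-$ (vanishing Neumann data). Conversely, a smooth solution with $\phi\equiv0$ on $\mathcal I^-$ is antipodally even, and a smooth solution with $\pi\equiv0$ on $\mathcal I^-$ is antipodally odd.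
   Context: Let $\mathbb R^{4,1}$ carry the metric $\eta=\mathrm{diag}(-1,1,1,1,1)$, with $x\cdot y=\eta_{\mu\nu}x^\mu y^\nu$. De Sitter space is $dS_4=\{x\in\mathbb R^{4,1}: x\cdot x=1\}$ with the induced metric $g$, Levi-Civita connection $\nabla$, and $\Box=\nabla_\mu\nabla^\mu$. The antipodal map is $x\mapsto -x$. Use global coordinates $x=(x^0,\sqrt{1+(x^0)^2}\,\omega)$ with $x^0\in\mathbb R$, $\omega\in S^3\subset\mathbb R^4$, and on the region $x^0\neq0$ set $z=1/x^0$; future infinity $\mathcal I^+$ corresponds to $z\to0^+$ and past infinity $\mathcal I^-$ to $z\to0^-$, with points of $\mathcal I^\pm$ labelled by $\omega\in S^3$ (the antipodal map sends $(x^0,\omega)\mapsto(-x^0,-\omega)$). The boundary data of a scalar field $\varphi$ are defined by $\phi|_{\mathcal I^\pm}(\omega)=\pm\lim_{z\to0^\pm}\varphi/z$ and $\pi|_{\mathcal I^\pm}(\omega)=\lim_{z\to0^\pm}\partial_z(\varphi/z)$, the limits taken at fixed $\omega$. *)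

theory Defs
  imports "HOL-Analysis.Analysis"
begin

text \<open>Ambient space R^{4,1} is modelled as real \<times> real^4: first component x^0,
  second component the spatial part (x^1,...,x^4).\<close>

type_synonym pt = "real \<times> (real^4)"

definition mink :: "pt \<Rightarrow> pt \<Rightarrow> real" where
  "mink x y = - fst x * fst y + snd x \<bullet> snd y"

definition dS4 :: "pt set" where
  "dS4 = {x. mink x x = 1}"

definition ddir :: "pt \<Rightarrow> (pt \<Rightarrow> complex) \<Rightarrow> pt \<Rightarrow> complex" where
  "ddir v F y = vector_derivative (\<lambda>s. F (y + s *\<^sub>R v)) (at 0)"

fun ddirs :: "pt list \<Rightarrow> (pt \<Rightarrow> complex) \<Rightarrow> pt \<Rightarrow> complex" where
  "ddirs [] F = F"
| "ddirs (v # vs) F = ddir v (ddirs vs F)"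

definition smooth_on :: "pt set \<Rightarrow> (pt \<Rightarrow> complex) \<Rightarrow> bool" where
  "smooth_on U F \<longleftrightarrow> (\<forall>vs. ddirs vs F differentiable_on U)"

definition box_amb :: "(pt \<Rightarrow> complex) \<Rightarrow> pt \<Rightarrow> complex" where
  "box_amb F x = (\<Sum>b\<in>Basis. complex_of_real (mink b b) * ddir b (ddir b F) x)"

text \<open>d'Alembertian of the induced metric on dS_4, computed from any smooth extension F
  of the field to a neighbourhood of dS_4 (hypersurface with unit spacelike normal x,
  mean curvature 4):  Box f = eta^{mu nu} d d F - x^mu x^nu d d F - 4 x^mu d F.\<close>
definition box_dS :: "(pt \<Rightarrow> complex) \<Rightarrow> pt \<Rightarrow> complex" where
  "box_dS F x = box_amb F x - ddir x (ddir x F) x - 4 * ddir x F x"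

definition dS_solution :: "(pt \<Rightarrow> complex) \<Rightarrow> bool" where
  "dS_solution \<phi> \<longleftrightarrow> (\<exists>U F. open U \<and> dS4 \<subseteq> U \<and> smooth_on U F \<and>
      (\<forall>x\<in>dS4. F x = \<phi> x) \<and> (\<forall>x\<in>dS4. box_dS F x - 2 * F x = 0))"

definition antipodally_even :: "(pt \<Rightarrow> complex) \<Rightarrow> bool" where
  "antipodally_even \<phi> \<longleftrightarrow> (\<forall>x\<in>dS4. \<phi> (- x) = \<phi> x)"

definition antipodally_odd :: "(pt \<Rightarrow> complex) \<Rightarrow> bool" where
  "antipodally_odd \<phi> \<longleftrightarrow> (\<forall>x\<in>dS4. \<phi> (- x) = - \<phi> x)"

definition gcoord :: "real \<Rightarrow> real^4 \<Rightarrow> pt" where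
  "gcoord t \<omega> = (t, sqrt (1 + t\<^sup>2) *\<^sub>R \<omega>)"

definition S3 :: "(real^4) set" where
  "S3 = sphere 0 1"

definition resc :: "(pt \<Rightarrow> complex) \<Rightarrow> real^4 \<Rightarrow> real \<Rightarrow> complex" where
  "resc \<phi> \<omega> z = \<phi> (gcoord (1 / z) \<omega>) / complex_of_real z"

definition dz_resc :: "(pt \<Rightarrow> complex) \<Rightarrow> real^4 \<Rightarrow> real \<Rightarrow> complex" where
  "dz_resc \<phi> \<omega> z = vector_derivative (resc \<phi> \<omega>) (at z)"

definition bd_phi_plus :: "(pt \<Rightarrow> complex) \<Rightarrow> real^4 \<Rightarrow> complex" where
  "bd_phi_plus \<phi> \<omega> = Lim (at_right 0) (resc \<phi> \<omega>)"

definition bd_phi_minus :: "(pt \<Rightarrow> complex) \<Rightarrow> real^4 \<Rightarrow> complex" where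
  "bd_phi_minus \<phi> \<omega> = - Lim (at_left 0) (resc \<phi> \<omega>)"

definition bd_pi_plus :: "(pt \<Rightarrow> complex) \<Rightarrow> real^4 \<Rightarrow> complex" where
  "bd_pi_plus \<phi> \<omega> = Lim (at_right 0) (dz_resc \<phi> \<omega>)"

definition bd_pi_minus :: "(pt \<Rightarrow> complex) \<Rightarrow> real^4 \<Rightarrow> complex" where
  "bd_pi_minus \<phi> \<omega> = Lim (at_left 0) (dz_resc \<phi> \<omega>)"

end

theory Submission
  imports Defs
begin

text \<open>De Sitter space is conformal to the Einstein cylinder \<open>(-\<pi>/2, \<pi>/2) \<times> S\<^sup>3\<close> through
  \<open>x\<^sup>0 = tan t\<close>, and \<open>\<phi> = cos t * \<Psi>\<close> turns \<open>\<box>\<phi> - 2\<phi> = 0\<close> into the conformally invariant wave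
  equation \<open>\<Psi>\<^sub>t\<^sub>t = \<Delta>\<Psi> - \<Psi>\<close>.  If \<open>M(t, r)\<close> is the mean of \<open>\<Psi>(t, -)\<close> over the geodesic sphere of radius
  \<open>r\<close> around \<open>w\<close>, then \<open>u = sin r * M\<close> satisfies \<open>u\<^sub>t\<^sub>t = u\<^sub>r\<^sub>r\<close>, so \<open>u\<^sub>t + u\<^sub>r\<close> depends on \<open>t + r\<close> only.
  Evaluated on \<open>r = 0\<close> and on \<open>t = 0\<close> this gives Kirchhoff's formula, which expresses \<open>\<Psi>(t, w)\<close> by a
  function \<open>G\<close> continuous on the whole real line; this yields the boundary limits.  For a field of
  antipodal parity \<open>\<epsilon>\<close> the initial data give \<open>G(\<plusminus>\<pi> - t) = - \<epsilon> G(t)\<close>, hence zero Dirichlet data in the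
  even case.  If an odd field has zero Dirichlet data at \<open>t = -\<pi>/2\<close>, letting \<open>t\<close> tend to \<open>-\<pi>/2\<close> in
  \<open>2 u(t, r) = \<integral> G\<close> over \<open>[t - r, t + r]\<close> makes \<open>G\<close> also antisymmetric about \<open>-\<pi>/2\<close>, so it vanishes.
  The Neumann statements follow because the time derivative of \<open>\<Psi>\<close> solves the same equation with
  the opposite parity.\<close>

section \<open>Iterated directional derivatives\<close>

text \<open>Boundary limits are taken at each fixed \<omega>, so control in mean, as from energies
  or spherical harmonics, would not be enough. Kirchhoff's formula gives single values of the field,
  and its integrand does not degenerate at \<open>t = \<plusminus>pi/2\<close>: great circles in the
  slice \<open>t = 0\<close> can be followed for any length. The subtracted \<Psi> in the wave
  equation is exactly what makes \<open>sin r * M\<close> satisfy the flat equation; another mass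
  would leave a tail inside the cone. The reflection law of \<open>G\<close> has a geometric source.
  The antipode of the point at distance \<open>r\<close> in direction \<open>n\<close> lies at
  distance \<open>pi - r\<close> in direction \<open>-n\<close>, and time is reversed as well; hence
  the outgoing null derivative changes sign, on top of the factor \<epsilon>. The converse is a
  uniqueness statement at the boundary, but \<Psi> is never extended past the open strip, so no
  Cauchy problem can be posed at \<open>t = -pi/2\<close>. Only pointwise limits are at hand; they
  pass through the spherical integral by dominated convergence. Uniqueness is applied to one parity
  part: the direct statement removes the other part from the boundary data.\<close>

lemma ddir_unique:
  assumes "(G has_derivative G') (at x)"
  shows "ddir v G x = G' v"
proof -
  have "((\<lambda>s. x + s *\<^sub>R v) has_derivative (\<lambda>s. s *\<^sub>R v)) (at (0::real))"
    by (auto intro!: derivative_eq_intros)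
  then have "(G \<circ> (\<lambda>s. x + s *\<^sub>R v) has_derivative G' \<circ> (\<lambda>s. s *\<^sub>R v)) (at 0)"
    by (rule diff_chain_at) (use assms in simp)
  moreover have "G' (s *\<^sub>R v) = s *\<^sub>R G' v" for s
    using assms has_derivative_linear linear_scale by blast
  ultimately have "((\<lambda>s. G (x + s *\<^sub>R v)) has_vector_derivative G' v) (at 0)"
    by (simp add: has_vector_derivative_def o_def)
  then show ?thesis
    unfolding ddir_def by (rule vector_derivative_at)
qed

lemma ddirs_append: "ddirs (vs @ ws) F = ddirs vs (ddirs ws F)"
  by (induction vs) auto

lemma smooth_on_ddir:
  assumes "smooth_on U F"
  shows "smooth_on U (ddir v F)"
proof -
  have "ddirs vs (ddir v F) differentiable_on U" for vs
    using assms ddirs_append[of vs "[v]" F] unfolding smooth_on_def by (metis ddirs.simps)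
  then show ?thesis
    by (simp add: smooth_on_def)
qed

lemma has_derivative_ddir:
  assumes "open U" "smooth_on U F" "x \<in> U"
  shows "(F has_derivative (\<lambda>v. ddir v F x)) (at x)"
proof -
  have "ddirs [] F differentiable_on U"
    using assms(2) unfolding smooth_on_def by blast
  then obtain F' where F': "(F has_derivative F') (at x)"
    using assms(1,3) by (auto simp: differentiable_on_eq_differentiable_at differentiable_def)
  then have "(\<lambda>v. ddir v F x) = F'"
    using ddir_unique by blast
  with F' show ?thesis by simp
qed

lemma linear_ddir:
  assumes "open U" "smooth_on U F" "x \<in> U"
  shows "linear (\<lambda>v. ddir v F x)"
  using has_derivative_ddir[OF assms] has_derivative_linear by blast

text \<open>\<open>smooth_on\<close> speaks of fixed directions only. The expansion moves a varying
  direction into scalar coefficients, which is how continuity and derivatives along moving frames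
  are obtained below.\<close>

lemma ddir_expand:
  assumes "open U" "smooth_on U F" "x \<in> U"
  shows "ddir v F x = (\<Sum>b\<in>Basis. (v \<bullet> b) *\<^sub>R ddir b F x)"
proof -
  interpret linear "\<lambda>v. ddir v F x" by (rule linear_ddir[OF assms])
  have "ddir v F x = ddir (\<Sum>b\<in>Basis. (v \<bullet> b) *\<^sub>R b) F x"
    by (simp add: euclidean_representation)
  then show ?thesis
    by (simp add: sum scale)
qed

lemma ddir_cong_open:
  assumes "open U" "x \<in> U" "\<And>y. y \<in> U \<Longrightarrow> F y = G y" "(G has_derivative G') (at x)"
  shows "ddir v F x = ddir v G x"
proof -
  have "(F has_derivative G') (at x)"
    using has_derivative_transform_within_open[OF assms(4,1,2)] assms(3) by auto
  then show ?thesis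
    using ddir_unique assms(4) by metis
qed

lemma ddir_ddir_expand:
  assumes "open U" "smooth_on U F" "x \<in> U"
  shows "ddir w (ddir v F) x = (\<Sum>b\<in>Basis. (v \<bullet> b) *\<^sub>R ddir w (ddir b F) x)"
proof -
  let ?G = "\<lambda>y. \<Sum>b\<in>Basis. (v \<bullet> b) *\<^sub>R ddir b F y"
  have G: "(?G has_derivative (\<lambda>w. \<Sum>b\<in>Basis. (v \<bullet> b) *\<^sub>R ddir w (ddir b F) x)) (at x)"
    by (intro derivative_intros has_derivative_ddir[OF assms(1) _ assms(3)] smooth_on_ddir assms)
  have "ddir w (ddir v F) x = ddir w ?G x"
    using assms(1,3) ddir_expand[OF assms(1,2)] G by (rule ddir_cong_open) auto
  also have "\<dots> = (\<Sum>b\<in>Basis. (v \<bullet> b) *\<^sub>R ddir w (ddir b F) x)"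
    using G by (rule ddir_unique)
  finally show ?thesis .
qed

lemma linear_ddir_ddir:
  assumes "open U" "smooth_on U F" "x \<in> U"
  shows "linear (\<lambda>v. ddir w (ddir v F) x)"
proof (rule linearI)
  note e = ddir_ddir_expand[OF assms, of w]
  show "ddir w (ddir (v + v') F) x = ddir w (ddir v F) x + ddir w (ddir v' F) x" for v v'
    unfolding e[of "v + v'"] e[of v] e[of v']
    by (simp add: inner_add_left scaleR_add_left sum.distrib)
  show "ddir w (ddir (r *\<^sub>R v) F) x = r *\<^sub>R ddir w (ddir v F) x" for r v
    unfolding e[of "r *\<^sub>R v"] e[of v] by (simp add: scaleR_sum_right)
qed

lemma ddir_curve:
  assumes "open U" "smooth_on U F" "c s \<in> U" "(c has_vector_derivative c') (at s within S)"
  shows "((\<lambda>s. F (c s)) has_vector_derivative ddir c' F (c s)) (at s within S)"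
proof -
  have "(F \<circ> c has_derivative (\<lambda>v. ddir v F (c s)) \<circ> (\<lambda>t. t *\<^sub>R c')) (at s within S)"
    using assms(4) has_derivative_ddir[OF assms(1-3)]
    by (intro diff_chain_within) (auto simp: has_vector_derivative_def has_derivative_at_withinI)
  moreover have "ddir (t *\<^sub>R c') F (c s) = t *\<^sub>R ddir c' F (c s)" for t
    by (rule linear_scale[OF linear_ddir[OF assms(1-3)]])
  ultimately show ?thesis
    by (simp add: has_vector_derivative_def o_def)
qed

text \<open>Product rule for the expansion in \<open>Basis\<close>: the coefficients contribute the
  term with \<open>v'\<close>, while in the other term \<open>v s\<close> is frozen before the outer
  derivative is taken.\<close>

lemma ddir_vector_field_curve:
  assumes U: "open U" "smooth_on U F" and c: "\<And>s. s \<in> S \<Longrightarrow> c s \<in> U" and s: "s \<in> S"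
    and c': "(c has_vector_derivative c') (at s within S)"
    and v': "(v has_vector_derivative v') (at s within S)"
  shows "((\<lambda>s. ddir (v s) F (c s)) has_vector_derivative
    ddir v' F (c s) + ddir c' (ddir (v s) F) (c s)) (at s within S)"
proof -
  have inner: "((\<lambda>s. v s \<bullet> b) has_vector_derivative v' \<bullet> b) (at s within S)" for b
    using bounded_linear.has_vector_derivative[OF bounded_linear_inner_left v'] .
  have "((\<lambda>s. \<Sum>b\<in>Basis. (v s \<bullet> b) *\<^sub>R ddir b F (c s)) has_vector_derivative
    (\<Sum>b\<in>Basis. (v s \<bullet> b) *\<^sub>R ddir c' (ddir b F) (c s) + (v' \<bullet> b) *\<^sub>R ddir b F (c s)))
    (at s within S)"
    by (intro has_vector_derivative_sum has_vector_derivative_scaleR ddir_curve[OF U(1)]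
        smooth_on_ddir U c s c' inner[unfolded has_real_derivative_iff_has_vector_derivative[symmetric]])
  then have "((\<lambda>s. ddir (v s) F (c s)) has_vector_derivative
    (\<Sum>b\<in>Basis. (v s \<bullet> b) *\<^sub>R ddir c' (ddir b F) (c s) + (v' \<bullet> b) *\<^sub>R ddir b F (c s)))
    (at s within S)"
    by (rule has_vector_derivative_transform[OF s, rotated]) (rule ddir_expand[OF U c])
  moreover have "(\<Sum>b\<in>Basis. (v s \<bullet> b) *\<^sub>R ddir c' (ddir b F) (c s) + (v' \<bullet> b) *\<^sub>R ddir b F (c s))
    = ddir v' F (c s) + ddir c' (ddir (v s) F) (c s)"
    unfolding ddir_expand[OF U c[OF s], of v'] ddir_ddir_expand[OF U c[OF s], of c' "v s"]
    by (simp add: sum.distrib)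
  ultimately show ?thesis by simp
qed

lemma smooth_on_imp_continuous_on:
  assumes "smooth_on U F"
  shows "continuous_on U F"
proof -
  have "ddirs [] F differentiable_on U"
    using assms unfolding smooth_on_def by blast
  then show ?thesis by (simp add: differentiable_imp_continuous_on)
qed

lemma continuous_on_smooth_compose:
  assumes "smooth_on U F" "continuous_on S c" "\<And>p. p \<in> S \<Longrightarrow> c p \<in> U"
  shows "continuous_on S (\<lambda>p. F (c p))"
  using continuous_on_compose2[OF smooth_on_imp_continuous_on[OF assms(1)] assms(2)] assms(3) by (simp add: image_subset_iff)

lemma continuous_on_ddir:
  assumes "open U" "smooth_on U F" "continuous_on S c" "\<And>p. p \<in> S \<Longrightarrow> c p \<in> U"
    "continuous_on S v"
  shows "continuous_on S (\<lambda>p. ddir (v p) F (c p))"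
proof -
  have "continuous_on S (\<lambda>p. \<Sum>b\<in>Basis. (v p \<bullet> b) *\<^sub>R ddir b F (c p))"
    by (intro continuous_intros continuous_on_smooth_compose[OF smooth_on_ddir[OF assms(2)]] assms)
  then show ?thesis
    by (rule continuous_on_eq) (simp add: ddir_expand[OF assms(1,2,4), symmetric])
qed

lemma continuous_on_ddir_ddir:
  assumes "open U" "smooth_on U F" "continuous_on S c" "\<And>p. p \<in> S \<Longrightarrow> c p \<in> U"
    "continuous_on S v" "continuous_on S w"
  shows "continuous_on S (\<lambda>p. ddir (w p) (ddir (v p) F) (c p))"
proof -
  have "continuous_on S (\<lambda>p. \<Sum>b\<in>Basis. (v p \<bullet> b) *\<^sub>R ddir (w p) (ddir b F) (c p))"
    by (intro continuous_intros continuous_on_ddir[OF assms(1) smooth_on_ddir[OF assms(2)]] assms)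
  then show ?thesis
    by (rule continuous_on_eq) (simp add: ddir_ddir_expand[OF assms(1,2,4), symmetric])
qed

text \<open>The proof differentiates
  \<open>F (x + s v + t w) - F (x + s v) = \<integral>\<^sub>0\<^sup>t \<partial>\<^sub>w F (x + s v + t' w) dt'\<close> under the integral sign
  first in \<open>s\<close> and then in \<open>t\<close>.\<close>

lemma ddir_commute:
  assumes U: "open U" "smooth_on U F" and x: "x \<in> U"
  shows "ddir v (ddir w F) x = ddir w (ddir v F) x"
proof -
  let ?p = "\<lambda>s t. x + s *\<^sub>R v + t *\<^sub>R w"
  have "continuous_on UNIV (\<lambda>(s, t). ?p s t)"
    by (auto simp: split_beta intro!: continuous_intros)
  then have "open ((\<lambda>(s, t). ?p s t) -` U)"
    using U(1) open_vimage by blast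
  moreover have "(0, 0) \<in> (\<lambda>(s, t). ?p s t) -` U"
    using x by simp
  ultimately obtain A B where AB: "open A" "open B" "(0, 0) \<in> A \<times> B"
      "A \<times> B \<subseteq> (\<lambda>(s, t). ?p s t) -` U"
    using open_prod_elim by metis
  obtain d1 d2 where d12: "d1 > 0" "ball (0::real) d1 \<subseteq> A" "d2 > 0" "ball (0::real) d2 \<subseteq> B"
    using AB open_contains_ball by (metis mem_Sigma_iff)
  \<comment> \<open>Halving puts the closed interval from \<open>-d\<close> to \<open>d\<close>
    inside both open balls.\<close>
  define d where "d = min d1 d2 / 2"
  have d: "d > 0" using d12 by (simp add: d_def)
  let ?I = "{-d..d}"
  have inU: "?p s t \<in> U" if "s \<in> ?I" "t \<in> ?I" for s t
  proof -
    have "s \<in> ball 0 d1" "t \<in> ball 0 d2"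
      using that d12 by (auto simp: d_def dist_real_def)
    then have "(s, t) \<in> A \<times> B" using d12 by blast
    then show ?thesis using AB(4) by auto
  qed
  have ps: "((\<lambda>s. ?p s t) has_vector_derivative v) (at s within S)" for s t S
    by (auto intro!: derivative_eq_intros simp: has_vector_derivative_def)
  have pt: "((\<lambda>t. ?p s t) has_vector_derivative w) (at t within S)" for s t S
    by (auto intro!: derivative_eq_intros simp: has_vector_derivative_def)
  have cont: "continuous_on (?I \<times> ?I) (\<lambda>(s, t). G (?p s t))" if "smooth_on U G" for G :: "pt \<Rightarrow> complex"
    unfolding split_beta
    by (rule continuous_on_smooth_compose[OF that]) (auto intro!: continuous_intros inU)
  \<comment> \<open>The base point \<open>-d\<close> instead of 0 keeps 0 in the interior of the
    interval, so that derivatives within the interval at 0 are two-sided.\<close>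
  have ftc: "integral {-d..t} (\<lambda>t. ddir w F (?p s t)) = F (?p s t) - F (?p s (-d))"
    if "s \<in> ?I" "t \<in> ?I" for s t
    by (rule integral_unique, rule fundamental_theorem_of_calculus)
      (use that in \<open>auto intro!: ddir_curve[OF U] inU pt\<close>)
  have D: "ddir v F (?p 0 t) - ddir v F (?p 0 (-d)) = integral {-d..t} (\<lambda>t. ddir v (ddir w F) (?p 0 t))"
    if t: "t \<in> ?I" for t
  proof -
    have sub: "?I \<times> {-d..t} \<subseteq> ?I \<times> ?I" using t by auto
    have "((\<lambda>s. integral (cbox (-d) t) (\<lambda>t. ddir w F (?p s t))) has_vector_derivative
      integral (cbox (-d) t) (\<lambda>t. ddir v (ddir w F) (?p 0 t))) (at 0 within ?I)"
    proof (rule leibniz_rule_vector_derivative)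
      show "((\<lambda>s. ddir w F (?p s t')) has_vector_derivative ddir v (ddir w F) (?p s t')) (at s within ?I)"
        if "s \<in> ?I" "t' \<in> cbox (- d) t" for s t'
        by (rule ddir_curve[OF U(1) smooth_on_ddir[OF U(2)] _ ps]) (use that t in \<open>auto intro!: inU\<close>)
      show "(\<lambda>t'. ddir w F (?p s t')) integrable_on cbox (- d) t" if "s \<in> ?I" for s
        by (intro integrable_continuous continuous_on_smooth_compose[OF smooth_on_ddir[OF U(2)]])
          (use that t in \<open>auto intro!: inU continuous_intros\<close>)
      show "continuous_on (?I \<times> cbox (- d) t) (\<lambda>(s, t). ddir v (ddir w F) (?p s t))"
        using continuous_on_subset[OF cont[OF smooth_on_ddir[OF smooth_on_ddir[OF U(2)]]] sub] by simp
    qed (use d in auto)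
    from this[unfolded box_real] have "((\<lambda>s. F (?p s t) - F (?p s (-d))) has_vector_derivative
      integral {-d..t} (\<lambda>t. ddir v (ddir w F) (?p 0 t))) (at 0 within ?I)"
      by (rule has_vector_derivative_transform[rotated -1]) (use d t ftc in auto)
    moreover have "((\<lambda>s. F (?p s t) - F (?p s (-d))) has_vector_derivative
      ddir v F (?p 0 t) - ddir v F (?p 0 (-d))) (at 0 within ?I)"
      using d t inU[of 0 t] inU[of 0 "-d"]
      by (intro has_vector_derivative_diff ddir_curve[OF U _ ps]) auto
    moreover have "at (0::real) within ?I = at 0"
      using d by (intro at_within_interior) auto
    ultimately show ?thesis
      using vector_derivative_unique_at by (metis (no_types, lifting))
  qed
  have "((\<lambda>t. integral {-d..t} (\<lambda>t. ddir v (ddir w F) (?p 0 t))) has_vector_derivative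
    ddir v (ddir w F) (?p 0 0)) (at 0 within ?I)"
    by (rule integral_has_vector_derivative, rule continuous_on_smooth_compose)
      (use d inU[of 0] in \<open>auto intro!: smooth_on_ddir U continuous_intros\<close>)
  then have "((\<lambda>t. ddir v F (?p 0 t) - ddir v F (?p 0 (-d))) has_vector_derivative
    ddir v (ddir w F) (?p 0 0)) (at 0 within ?I)"
    by (rule has_vector_derivative_transform[rotated -1]) (use d D in auto)
  moreover have "((\<lambda>t. ddir v F (?p 0 t) - ddir v F (?p 0 (-d))) has_vector_derivative
    ddir w (ddir v F) (?p 0 0) - 0) (at 0 within ?I)"
    using d inU[of 0 0]
    by (intro has_vector_derivative_diff ddir_curve[OF U(1) smooth_on_ddir[OF U(2)] _ pt]
        has_vector_derivative_const) auto
  moreover have "at (0::real) within ?I = at 0"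
    using d by (intro at_within_interior) auto
  ultimately show ?thesis
    using vector_derivative_unique_at by (metis (no_types, lifting) diff_zero scaleR_zero_left add.right_neutral)
qed

text \<open>Each iterated derivative is replaced by a member of the class that equals it on
  \<open>U\<close>. Equality on \<open>U\<close> is enough because \<open>U\<close> is open, and no
  more can be asked, since \<open>ddir\<close> is uncontrolled outside \<open>U\<close>.\<close>

lemma smooth_on_coinduct:
  assumes U: "open U" and "P F"
    and diff: "\<And>G. P G \<Longrightarrow> G differentiable_on U"
    and step: "\<And>G v. P G \<Longrightarrow> \<exists>H. P H \<and> (\<forall>x\<in>U. ddir v G x = H x)"
  shows "smooth_on U F"
proof -
  have *: "\<exists>H. P H \<and> (\<forall>x\<in>U. ddirs vs F x = H x)" for vs
  proof (induction vs)
    case Nil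
    then show ?case using \<open>P F\<close> by auto
  next
    case (Cons v vs)
    then obtain H where H: "P H" "\<And>x. x \<in> U \<Longrightarrow> ddirs vs F x = H x" by blast
    obtain K where K: "P K" "\<And>x. x \<in> U \<Longrightarrow> ddir v H x = K x" using step[OF H(1)] by blast
    have "ddirs (v # vs) F x = K x" if "x \<in> U" for x
    proof -
      obtain H' where "(H has_derivative H') (at x)"
        using diff[OF H(1)] U \<open>x \<in> U\<close>
        by (auto simp: differentiable_on_eq_differentiable_at differentiable_def)
      then show ?thesis
        using ddir_cong_open[OF U that H(2)] K(2)[OF that] by auto
    qed
    with K(1) show ?case by blast
  qed
  have "ddirs vs F differentiable_on U" for vs
  proof -
    obtain H where H: "P H" "\<And>x. x \<in> U \<Longrightarrow> ddirs vs F x = H x" using * by blast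
    show ?thesis
      using differentiable_transform_within[of _ _ U 1 "ddirs vs F"] diff[OF H(1)] H(2)
      by (auto simp: differentiable_on_def)
  qed
  then show ?thesis by (simp add: smooth_on_def)
qed

section \<open>Orthonormal frames and polar coordinates on the 3-sphere\<close>

definition orthonormal4 :: "real^4 \<Rightarrow> real^4 \<Rightarrow> real^4 \<Rightarrow> real^4 \<Rightarrow> bool" where
  "orthonormal4 w a b c \<longleftrightarrow> w \<bullet> w = 1 \<and> a \<bullet> a = 1 \<and> b \<bullet> b = 1 \<and> c \<bullet> c = 1 \<and>
    w \<bullet> a = 0 \<and> w \<bullet> b = 0 \<and> w \<bullet> c = 0 \<and> a \<bullet> b = 0 \<and> a \<bullet> c = 0 \<and> b \<bullet> c = 0"

lemma orthonormal4_exists: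
  assumes "norm w = 1"
  obtains a b c where "orthonormal4 w a b c"
proof -
  obtain S :: "(real^4) set" where S: "w \<in> S" "pairwise orthogonal S" "\<And>x. x \<in> S \<Longrightarrow> norm x = 1"
    "independent S" "card S = DIM(real^4)" "span S = UNIV"
    using vector_in_orthonormal_basis[OF assms] by metis
  have "card (S - {w}) = 3"
    using S(1,5) by simp
  then obtain a b c where abc: "S - {w} = {a, b, c}" "a \<noteq> b" "b \<noteq> c" "a \<noteq> c"
    using card_3_iff[of "S - {w}"] by blast
  then have "a \<in> S" "b \<in> S" "c \<in> S" "w \<noteq> a" "w \<noteq> b" "w \<noteq> c" by blast+
  with S abc have "orthonormal4 w a b c"
    unfolding orthonormal4_def
    by (auto simp: pairwise_def orthogonal_def norm_eq_1[symmetric])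
  then show ?thesis by (rule that)
qed

text \<open>Basis independence of the trace. It allows the ambient Laplacian to be computed in a
  frame adapted to a point of a geodesic sphere: the position vector, the radial direction and two
  directions tangent to the sphere.\<close>

lemma sum_Basis_eq_orthonormal4:
  fixes B :: "real^4 \<Rightarrow> real^4 \<Rightarrow> complex"
  assumes B: "\<And>x. linear (B x)" "\<And>y. linear (\<lambda>x. B x y)"
    and o: "orthonormal4 w a b c"
  shows "(\<Sum>i\<in>Basis. B i i) = B w w + B a a + B b b + B c c"
proof -
  let ?S = "{w, a, b, c}"
  have ne: "w \<noteq> a" "w \<noteq> b" "w \<noteq> c" "a \<noteq> b" "a \<noteq> c" "b \<noteq> c"
    using o by (auto simp: orthonormal4_def)
  have orth: "pairwise orthogonal ?S"
    using o by (auto simp: orthonormal4_def pairwise_def orthogonal_def inner_commute)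
  have "0 \<notin> ?S"
    using o by (auto simp: orthonormal4_def)
  then have "independent ?S"
    using orth pairwise_orthogonal_independent by blast
  moreover have "card ?S = 4"
    using ne by simp
  ultimately have "UNIV \<subseteq> span ?S"
    using card_ge_dim_independent[of ?S UNIV] by (simp add: dim_UNIV)
  then have exp: "(\<Sum>f\<in>?S. (x \<bullet> f) *\<^sub>R f) = x" for x
    using orthonormal_basis_expand[OF orth _ _, of x] o
    by (auto simp: orthonormal4_def norm_eq_1)
  have B_expand: "B x y = (\<Sum>f\<in>?S. \<Sum>g\<in>?S. ((x \<bullet> f) * (y \<bullet> g)) *\<^sub>R B f g)" for x y
  proof -
    have "B x y = B (\<Sum>f\<in>?S. (x \<bullet> f) *\<^sub>R f) (\<Sum>g\<in>?S. (y \<bullet> g) *\<^sub>R g)"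
      by (simp only: exp)
    also have "\<dots> = (\<Sum>f\<in>?S. (x \<bullet> f) *\<^sub>R B f (\<Sum>g\<in>?S. (y \<bullet> g) *\<^sub>R g))"
      by (simp only: linear_sum[OF B(2)] linear_scale[OF B(2)])
    also have "\<dots> = (\<Sum>f\<in>?S. \<Sum>g\<in>?S. ((x \<bullet> f) * (y \<bullet> g)) *\<^sub>R B f g)"
      by (simp only: linear_sum[OF B(1)] linear_scale[OF B(1)] scaleR_sum_right scaleR_scaleR)
    finally show ?thesis .
  qed
  have *: "f \<bullet> g = (\<Sum>i\<in>Basis. (i \<bullet> f) * (i \<bullet> g))" for f g :: "real^4"
    by (subst euclidean_inner) (simp add: inner_commute)
  have "(\<Sum>i\<in>Basis. B i i) = (\<Sum>i\<in>Basis. \<Sum>f\<in>?S. \<Sum>g\<in>?S. ((i \<bullet> f) * (i \<bullet> g)) *\<^sub>R B f g)"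
    by (rule sum.cong[OF refl]) (rule B_expand)
  also have "\<dots> = (\<Sum>f\<in>?S. \<Sum>g\<in>?S. \<Sum>i\<in>Basis. ((i \<bullet> f) * (i \<bullet> g)) *\<^sub>R B f g)"
    by (subst sum.swap, rule sum.cong[OF refl], rule sum.swap)
  also have "\<dots> = (\<Sum>f\<in>?S. \<Sum>g\<in>?S. (f \<bullet> g) *\<^sub>R B f g)"
  proof (intro sum.cong refl)
    show "(\<Sum>i\<in>Basis. ((i \<bullet> f) * (i \<bullet> g)) *\<^sub>R B f g) = (f \<bullet> g) *\<^sub>R B f g" for f g
      using *[of f g] by (simp add: scaleR_sum_left[symmetric])
  qed
  also have "\<dots> = B w w + B a a + B b b + B c c"
    using ne o by (simp add: orthonormal4_def inner_commute)
  finally show ?thesis .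
qed

definition great_circle :: "real^4 \<Rightarrow> real^4 \<Rightarrow> real \<Rightarrow> real^4" where
  "great_circle w n r = cos r *\<^sub>R w + sin r *\<^sub>R n"

definition great_circle' :: "real^4 \<Rightarrow> real^4 \<Rightarrow> real \<Rightarrow> real^4" where
  "great_circle' w n r = cos r *\<^sub>R n - sin r *\<^sub>R w"

text \<open>Here \<open>\<partial>\<^sub>\<theta> polar = polar\<^sub>\<theta>\<close> but \<open>\<partial>\<^sub>\<alpha> polar = sin \<theta> * polar\<^sub>\<alpha>\<close>: the normalised vector \<open>polar\<^sub>\<alpha>\<close> has
  no singularity at the poles.\<close>

definition polar :: "real^4 \<Rightarrow> real^4 \<Rightarrow> real^4 \<Rightarrow> real \<times> real \<Rightarrow> real^4" where
  "polar a b c p = sin (fst p) *\<^sub>R (cos (snd p) *\<^sub>R a + sin (snd p) *\<^sub>R b) + cos (fst p) *\<^sub>R c"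

definition polar\<^sub>\<theta> :: "real^4 \<Rightarrow> real^4 \<Rightarrow> real^4 \<Rightarrow> real \<times> real \<Rightarrow> real^4" where
  "polar\<^sub>\<theta> a b c p = cos (fst p) *\<^sub>R (cos (snd p) *\<^sub>R a + sin (snd p) *\<^sub>R b) - sin (fst p) *\<^sub>R c"

definition polar\<^sub>\<alpha> :: "real^4 \<Rightarrow> real^4 \<Rightarrow> real \<times> real \<Rightarrow> real^4" where
  "polar\<^sub>\<alpha> a b p = cos (snd p) *\<^sub>R b - sin (snd p) *\<^sub>R a"

lemma sin_cos_squares: "sin x * sin x = 1 - cos x * cos (x::real)"
  using sin_squared_eq[of x] by (simp add: power2_eq_square)

text \<open>Undoes a rotation in the plane of \<open>w\<close> and \<open>n\<close>. It expresses
  the initial direction of a great circle by the position and velocity at \<open>r\<close>, and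
  likewise the equatorial vector of polar coordinates by \<open>polar\<close> and
  \<open>polar\<^sub>\<theta>\<close>.\<close>

lemma rotate_back:
  fixes n w :: "'a::real_vector"
  shows "cos r *\<^sub>R (cos r *\<^sub>R n - sin r *\<^sub>R w) + sin r *\<^sub>R (cos r *\<^sub>R w + sin r *\<^sub>R n) = n"
  by (simp add: algebra_simps)
    (simp only: scaleR_add_left[symmetric] sin_cos_squared_add3 scaleR_one)

lemma orthonormal4_polar:
  assumes "orthonormal4 w a b c"
  shows "orthonormal4 w (polar a b c p) (polar\<^sub>\<theta> a b c p) (polar\<^sub>\<alpha> a b p)"
  using assms unfolding orthonormal4_def polar_def polar\<^sub>\<theta>_def polar\<^sub>\<alpha>_def
  by (simp add: inner_add_left inner_add_right inner_diff_left inner_diff_right inner_commute)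
     (simp add: algebra_simps sin_cos_squares)

lemma orthonormal4_great_circle:
  assumes "orthonormal4 w n b c"
  shows "orthonormal4 (great_circle w n r) (great_circle' w n r) b c"
  using assms unfolding orthonormal4_def great_circle_def great_circle'_def
  by (simp add: inner_add_left inner_add_right inner_diff_left inner_diff_right inner_commute)

lemma norm_great_circle:
  assumes "orthonormal4 w n b c"
  shows "norm (great_circle w n r) = 1"
  using orthonormal4_great_circle[OF assms, of r] by (simp add: orthonormal4_def norm_eq_1)

lemma orthonormal4_minus:
  "orthonormal4 w a b c \<Longrightarrow> orthonormal4 w (-a) (-b) (-c)"
  by (simp add: orthonormal4_def)

lemma polar_minus: "polar (-a) (-b) (-c) p = - polar a b c p"
  by (simp add: polar_def algebra_simps)

lemma great_circle_has_vector_derivative: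
  "(great_circle w n has_vector_derivative great_circle' w n r) (at r within S)"
  "(great_circle' w n has_vector_derivative - great_circle w n r) (at r within S)"
  unfolding great_circle_def great_circle'_def has_vector_derivative_def
  by (auto intro!: derivative_eq_intros simp: algebra_simps)

text \<open>Fubini, in the order that puts the differentiated variable innermost; the fundamental
  theorem then leaves only boundary differences. For polar angles these cancel by the factor
  \<open>sin \<theta>\<close> at the poles and by periodicity in \<alpha>.\<close>

lemma integral_divergence_rectangle:
  fixes P Q P' Q' :: "real \<times> real \<Rightarrow> complex"
  assumes P: "\<And>x y. x \<in> {a..b} \<Longrightarrow> y \<in> {c..d} \<Longrightarrow>
      ((\<lambda>x. P (x, y)) has_vector_derivative P' (x, y)) (at x within {a..b})"
    and Q: "\<And>x y. x \<in> {a..b} \<Longrightarrow> y \<in> {c..d} \<Longrightarrow>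
      ((\<lambda>y. Q (x, y)) has_vector_derivative Q' (x, y)) (at y within {c..d})"
    and cont: "continuous_on (cbox (a, c) (b, d)) P'" "continuous_on (cbox (a, c) (b, d)) Q'"
    and boundary: "\<And>y. P (a, y) = P (b, y)" "\<And>x. Q (x, c) = Q (x, d)"
    and le: "a \<le> b" "c \<le> d"
  shows "integral (cbox (a, c) (b, d)) (\<lambda>p. P' p + Q' p) = 0"
proof -
  have "integral (cbox (a, c) (b, d)) P' = integral (cbox a b) (\<lambda>x. integral (cbox c d) (\<lambda>y. P' (x, y)))"
    by (rule integral_prod_continuous[OF cont(1)])
  also have "\<dots> = integral (cbox c d) (\<lambda>y. integral (cbox a b) (\<lambda>x. P' (x, y)))"
    by (rule integral_swap_continuous) (use cont(1) in simp)
  also have "\<dots> = integral (cbox c d) (\<lambda>y. 0)"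
  proof (rule integral_cong)
    fix y assume "y \<in> cbox c d"
    then have "((\<lambda>x. P' (x, y)) has_integral P (b, y) - P (a, y)) {a..b}"
      using le P by (intro fundamental_theorem_of_calculus) auto
    then show "integral (cbox a b) (\<lambda>x. P' (x, y)) = 0"
      by (simp add: boundary integral_unique)
  qed
  finally have "integral (cbox (a, c) (b, d)) P' = 0" by simp
  moreover have "integral (cbox (a, c) (b, d)) Q' = integral (cbox a b) (\<lambda>x. integral (cbox c d) (\<lambda>y. Q' (x, y)))"
    by (rule integral_prod_continuous[OF cont(2)])
  moreover have "\<dots> = integral (cbox a b) (\<lambda>x. 0)"
  proof (rule integral_cong)
    fix x assume "x \<in> cbox a b"
    then have "((\<lambda>y. Q' (x, y)) has_integral Q (x, d) - Q (x, c)) {c..d}"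
      using le Q by (intro fundamental_theorem_of_calculus) auto
    then show "integral (cbox c d) (\<lambda>y. Q' (x, y)) = 0"
      by (simp add: boundary integral_unique)
  qed
  ultimately show ?thesis
    using integral_add[OF integrable_continuous[OF cont(1)] integrable_continuous[OF cont(2)]] by simp
qed

section \<open>Spherical means and Kirchhoff's formula on the Einstein cylinder\<close>

abbreviation "angles \<equiv> cbox (0::real, 0::real) (pi, 2 * pi)"

text \<open>The Laplacian of the 3-sphere at \<open>y\<close> is the ambient Laplacian minus \<open>\<partial>\<^sub>y\<partial>\<^sub>y + 3 \<partial>\<^sub>y\<close>.\<close>

locale cylinder_wave =
  fixes \<Psi> :: "pt \<Rightarrow> complex" and V :: "pt set"
  assumes V: "open V" "smooth_on V \<Psi>"
    and dom: "\<And>t y. \<bar>t\<bar> < pi/2 \<Longrightarrow> norm y = 1 \<Longrightarrow> (t, y) \<in> V"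
    and wave: "\<And>t y. \<bar>t\<bar> < pi/2 \<Longrightarrow> norm y = 1 \<Longrightarrow>
      ddir (1, 0) (ddir (1, 0) \<Psi>) (t, y) =
      (\<Sum>b\<in>Basis. ddir (0, b) (ddir (0, b) \<Psi>) (t, y)) - ddir (0, y) (ddir (0, y) \<Psi>) (t, y)
      - 3 *\<^sub>R ddir (0, y) \<Psi> (t, y) - \<Psi> (t, y)"
begin

text \<open>\<open>ray w n t r\<close> is the derivative of \<open>sin r * \<Psi> (t, great_circle w n r)\<close> in the outgoing
  null direction \<open>\<partial>\<^sub>t + \<partial>\<^sub>r\<close>.\<close>

definition ray :: "real^4 \<Rightarrow> real^4 \<Rightarrow> real \<Rightarrow> real \<Rightarrow> complex" where
  "ray w n t r = sin r *\<^sub>R ddir (1, great_circle' w n r) \<Psi> (t, great_circle w n r)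
    + cos r *\<^sub>R \<Psi> (t, great_circle w n r)"

text \<open>Not normalised: the total weight is \<open>4 * pi\<close>. The frame stays a parameter
  because the integral runs over angles; its choice is seen to be immaterial only through
  \<open>kirchhoff\<close>, for times in the strip.\<close>

definition ray_mean :: "real^4 \<Rightarrow> real^4 \<Rightarrow> real^4 \<Rightarrow> real^4 \<Rightarrow> real \<Rightarrow> real \<Rightarrow> complex" where
  "ray_mean w a b c t r = integral angles (\<lambda>p. sin (fst p) *\<^sub>R ray w (polar a b c p) t r)"

section \<open>The wave equation along characteristic cones\<close>

lemma wave_orthonormal4:
  assumes t: "\<bar>t\<bar> < pi/2" and o: "orthonormal4 y f g h"
  shows "ddir (1, 0) (ddir (1, 0) \<Psi>) (t, y) = ddir (0, f) (ddir (0, f) \<Psi>) (t, y)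
    + ddir (0, g) (ddir (0, g) \<Psi>) (t, y) + ddir (0, h) (ddir (0, h) \<Psi>) (t, y)
    - 3 *\<^sub>R ddir (0, y) \<Psi> (t, y) - \<Psi> (t, y)"
proof -
  have y: "norm y = 1" using o by (simp add: orthonormal4_def norm_eq_1)
  have L: "linear (\<lambda>v::real^4. (0::real, v))"
    by (rule linearI) auto
  have "(\<Sum>b\<in>Basis. ddir (0, b) (ddir (0, b) \<Psi>) (t, y)) = ddir (0, y) (ddir (0, y) \<Psi>) (t, y)
    + ddir (0, f) (ddir (0, f) \<Psi>) (t, y)
    + ddir (0, g) (ddir (0, g) \<Psi>) (t, y) + ddir (0, h) (ddir (0, h) \<Psi>) (t, y)"
  proof (rule sum_Basis_eq_orthonormal4[where B = "\<lambda>v w. ddir (0, v) (ddir (0, w) \<Psi>) (t, y)", OF _ _ o])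
    show "linear (\<lambda>w. ddir (0, v) (ddir (0, w) \<Psi>) (t, y))" for v
      using linear_compose[OF L linear_ddir_ddir[OF V dom[OF t y]]] by (simp add: o_def)
    show "linear (\<lambda>v. ddir (0, v) (ddir (0, w) \<Psi>) (t, y))" for w
      using linear_compose[OF L linear_ddir[OF V(1) smooth_on_ddir[OF V(2)] dom[OF t y]]]
      by (simp add: o_def)
  qed
  then show ?thesis
    using wave[OF t y] by simp
qed

text \<open>The operator \<open>\<partial>\<^sub>r - \<partial>\<^sub>t\<close> is applied after
  \<open>\<partial>\<^sub>t + \<partial>\<^sub>r\<close>. The wave equation cancels the second
  derivatives in time and in the radial direction, and its term \<open>- \<Psi>\<close> cancels the
  one from the second derivative of \<open>sin r\<close>. The derivatives along the position vector
  add up to \<open>3 - 1 = 2\<close>, which together with \<open>2 * cos r\<close> times the radial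
  derivative is twice the derivative along \<open>n\<close>.\<close>

lemma ray_deriv_along_cone:
  assumes o: "orthonormal4 w n b c" and S: "\<And>r. r \<in> S \<Longrightarrow> \<bar>t0 - r\<bar> < pi/2" and r: "r \<in> S"
  defines "x \<equiv> (t0 - r, great_circle w n r)"
  shows "((\<lambda>r. ray w n (t0 - r) r) has_vector_derivative
    2 *\<^sub>R ddir (0, n) \<Psi> x - sin r *\<^sub>R (ddir (0, b) (ddir (0, b) \<Psi>) x + ddir (0, c) (ddir (0, c) \<Psi>) x))
    (at r within S)"
proof -
  define y e where "y = great_circle w n r" and "e = great_circle' w n r"
  have inV: "(t0 - r, great_circle w n r) \<in> V" if "r \<in> S" for r
    using dom S[OF that] norm_great_circle[OF o] by blast
  have x: "x \<in> V" using inV[OF r] by (simp add: x_def)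
  have curve: "((\<lambda>r. (t0 - r, great_circle w n r)) has_vector_derivative (-1, e)) (at r within S)"
    unfolding e_def
    by (intro has_vector_derivative_Pair great_circle_has_vector_derivative)
      (auto intro!: derivative_eq_intros simp: has_vector_derivative_def)
  have dir: "((\<lambda>r. (1, great_circle' w n r)) has_vector_derivative (0::real, - y)) (at r within S)"
    unfolding y_def
    by (intro has_vector_derivative_Pair great_circle_has_vector_derivative has_vector_derivative_const)
  have "((\<lambda>r. ray w n (t0 - r) r) has_vector_derivative
    (sin r *\<^sub>R (ddir (0, -y) \<Psi> x + ddir (-1, e) (ddir (1, e) \<Psi>) x) + cos r *\<^sub>R ddir (1, e) \<Psi> x)
    + (cos r *\<^sub>R ddir (-1, e) \<Psi> x + (- sin r) *\<^sub>R \<Psi> x)) (at r within S)"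
    unfolding ray_def x_def e_def y_def
    by (intro has_vector_derivative_add has_vector_derivative_scaleR
        ddir_vector_field_curve[OF V inV r curve[unfolded e_def] dir[unfolded y_def]]
        ddir_curve[OF V inV[OF r] curve[unfolded e_def]] DERIV_sin DERIV_cos has_field_derivative_at_within)
  moreover have "(sin r *\<^sub>R (ddir (0, -y) \<Psi> x + ddir (-1, e) (ddir (1, e) \<Psi>) x) + cos r *\<^sub>R ddir (1, e) \<Psi> x)
    + (cos r *\<^sub>R ddir (-1, e) \<Psi> x + (- sin r) *\<^sub>R \<Psi> x) =
    2 *\<^sub>R ddir (0, n) \<Psi> x - sin r *\<^sub>R (ddir (0, b) (ddir (0, b) \<Psi>) x + ddir (0, c) (ddir (0, c) \<Psi>) x)"
  proof -
    interpret D: linear "\<lambda>v. ddir v \<Psi> x" by (rule linear_ddir[OF V x])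
    have D2: "linear (\<lambda>v. ddir v (ddir w \<Psi>) x)" "linear (\<lambda>v. ddir w (ddir v \<Psi>) x)" for w
      using linear_ddir[OF V(1) smooth_on_ddir[OF V(2)] x] linear_ddir_ddir[OF V x] by blast+
    have sp: "(1::real, e) = (1, 0) + (0, e)" "(-1::real, e) = (0, e) - (1, 0)" "(0::real, -y) = - (0, y)"
      by auto
    \<comment> \<open>The mixed terms cancel because second derivatives commute.\<close>
    have f1: "ddir (-1, e) (ddir (1, e) \<Psi>) x = ddir (0, e) (ddir (0, e) \<Psi>) x - ddir (1, 0) (ddir (1, 0) \<Psi>) x"
      unfolding sp linear_add[OF D2(2)] linear_diff[OF D2(1)]
      using ddir_commute[OF V x, of "(1, 0)" "(0, e)"] by simp
    have f2: "ddir (1, 0) (ddir (1, 0) \<Psi>) x = ddir (0, e) (ddir (0, e) \<Psi>) x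
        + ddir (0, b) (ddir (0, b) \<Psi>) x + ddir (0, c) (ddir (0, c) \<Psi>) x
        - 3 *\<^sub>R ddir (0, y) \<Psi> x - \<Psi> x"
      using wave_orthonormal4[OF S[OF r] orthonormal4_great_circle[OF o, of r]]
      by (simp add: x_def y_def e_def)
    have "(0, n) = cos r *\<^sub>R (0::real, e) + sin r *\<^sub>R (0, y)"
      using rotate_back[of r n w] by (simp add: e_def y_def great_circle_def great_circle'_def)
    then have f3: "ddir (0, n) \<Psi> x = cos r *\<^sub>R ddir (0, e) \<Psi> x + sin r *\<^sub>R ddir (0, y) \<Psi> x"
      by (simp only: D.add D.scale)
    have f4: "ddir (1, e) \<Psi> x = ddir (1, 0) \<Psi> x + ddir (0, e) \<Psi> x"
      "ddir (-1, e) \<Psi> x = ddir (0, e) \<Psi> x - ddir (1, 0) \<Psi> x"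
      "ddir (0, -y) \<Psi> x = - ddir (0, y) \<Psi> x"
      unfolding sp D.add D.diff D.neg by auto
    show ?thesis
      unfolding f1 f2 f3 f4 by (simp add: scaleR_conv_of_real algebra_simps)
  qed
  ultimately show ?thesis by simp
qed

lemma polar_has_vector_derivative:
  "((\<lambda>\<theta>. polar a b c (\<theta>, \<alpha>)) has_vector_derivative polar\<^sub>\<theta> a b c (\<theta>, \<alpha>)) (at \<theta> within S)"
  "((\<lambda>\<theta>. polar\<^sub>\<theta> a b c (\<theta>, \<alpha>)) has_vector_derivative - polar a b c (\<theta>, \<alpha>)) (at \<theta> within S)"
  "((\<lambda>\<alpha>. polar a b c (\<theta>, \<alpha>)) has_vector_derivative sin \<theta> *\<^sub>R polar\<^sub>\<alpha> a b (\<theta>, \<alpha>)) (at \<alpha> within S)"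
  "((\<lambda>\<alpha>. polar\<^sub>\<alpha> a b (\<theta>, \<alpha>)) has_vector_derivative - (cos \<alpha> *\<^sub>R a + sin \<alpha> *\<^sub>R b)) (at \<alpha> within S)"
  unfolding polar_def polar\<^sub>\<theta>_def polar\<^sub>\<alpha>_def has_vector_derivative_def
  by (auto intro!: derivative_eq_intros simp: algebra_simps)

lemma continuous_on_polar [continuous_intros]:
  fixes S :: "'a::t2_space set"
  shows
  "continuous_on S f \<Longrightarrow> continuous_on S (\<lambda>x. polar a b c (f x))"
  "continuous_on S f \<Longrightarrow> continuous_on S (\<lambda>x. polar\<^sub>\<theta> a b c (f x))"
  "continuous_on S f \<Longrightarrow> continuous_on S (\<lambda>x. polar\<^sub>\<alpha> a b (f x))"
  unfolding polar_def polar\<^sub>\<theta>_def polar\<^sub>\<alpha>_def by (auto intro!: continuous_intros)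

lemma continuous_on_great_circle [continuous_intros]:
  fixes S :: "'a::t2_space set"
  shows
  "continuous_on S w \<Longrightarrow> continuous_on S n \<Longrightarrow> continuous_on S r \<Longrightarrow>
    continuous_on S (\<lambda>x. great_circle (w x) (n x) (r x))"
  "continuous_on S w \<Longrightarrow> continuous_on S n \<Longrightarrow> continuous_on S r \<Longrightarrow>
    continuous_on S (\<lambda>x. great_circle' (w x) (n x) (r x))"
  unfolding great_circle_def great_circle'_def by (auto intro!: continuous_intros)

text \<open>The derivative of the integrand of \<open>ray_mean\<close> along the ingoing cone is a divergence on
  the 2-sphere.\<close>

lemma cone_derivative_mean_zero:
  fixes r :: real
  assumes o: "orthonormal4 w a b c" and t: "\<bar>t\<bar> < pi/2"
  defines "x p \<equiv> (t, great_circle w (polar a b c p) r)"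
  shows "integral angles (\<lambda>p. sin (fst p) *\<^sub>R (2 *\<^sub>R ddir (0, polar a b c p) \<Psi> (x p)
    - sin r *\<^sub>R (ddir (0, polar\<^sub>\<theta> a b c p) (ddir (0, polar\<^sub>\<theta> a b c p) \<Psi>) (x p)
      + ddir (0, polar\<^sub>\<alpha> a b p) (ddir (0, polar\<^sub>\<alpha> a b p) \<Psi>) (x p)))) = 0"
proof -
  define m where "m p = cos (snd p) *\<^sub>R a + sin (snd p) *\<^sub>R b" for p :: "real \<times> real"
  define P' where "P' p = sin (fst p) *\<^sub>R (ddir (0, - polar a b c p) \<Psi> (x p)
      + ddir (0, sin r *\<^sub>R polar\<^sub>\<theta> a b c p) (ddir (0, polar\<^sub>\<theta> a b c p) \<Psi>) (x p))
      + cos (fst p) *\<^sub>R ddir (0, polar\<^sub>\<theta> a b c p) \<Psi> (x p)" for p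
  define Q' where "Q' p = ddir (0, - m p) \<Psi> (x p)
      + ddir (0, sin r *\<^sub>R sin (fst p) *\<^sub>R polar\<^sub>\<alpha> a b p) (ddir (0, polar\<^sub>\<alpha> a b p) \<Psi>) (x p)" for p
  have xV: "x p \<in> V" for p
    unfolding x_def using dom[OF t norm_great_circle[OF orthonormal4_polar[OF o]]] .
  have x\<theta>: "((\<lambda>\<theta>. x (\<theta>, \<alpha>)) has_vector_derivative (0, sin r *\<^sub>R polar\<^sub>\<theta> a b c (\<theta>, \<alpha>))) (at \<theta> within S)" for \<theta> \<alpha> S
    unfolding x_def great_circle_def
    by (intro has_vector_derivative_Pair has_vector_derivative_const)
      (rule has_vector_derivative_eq_rhs, rule has_vector_derivative_add[OF has_vector_derivative_const],
       rule has_vector_derivative_scaleR[OF _ polar_has_vector_derivative(1)], auto)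
  have x\<alpha>: "((\<lambda>\<alpha>. x (\<theta>, \<alpha>)) has_vector_derivative (0, sin r *\<^sub>R sin \<theta> *\<^sub>R polar\<^sub>\<alpha> a b (\<theta>, \<alpha>))) (at \<alpha> within S)" for \<theta> \<alpha> S
    unfolding x_def great_circle_def
    by (intro has_vector_derivative_Pair has_vector_derivative_const)
      (rule has_vector_derivative_eq_rhs, rule has_vector_derivative_add[OF has_vector_derivative_const],
       rule has_vector_derivative_scaleR[OF _ polar_has_vector_derivative(3)], auto)
  have cx: "continuous_on S x" for S
    unfolding x_def by (intro continuous_intros)
  \<comment> \<open>The flux is the spherical gradient in coordinates: the area density
    \<open>sin \<theta>\<close> survives in the meridional component and cancels in the azimuthal
    one, since \<open>polar\<^sub>\<alpha>\<close> is already normalised.\<close>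
  have "integral angles (\<lambda>p. P' p + Q' p) = 0"
  proof (rule integral_divergence_rectangle[where P = "\<lambda>p. sin (fst p) *\<^sub>R ddir (0, polar\<^sub>\<theta> a b c p) \<Psi> (x p)"
        and Q = "\<lambda>p. ddir (0, polar\<^sub>\<alpha> a b p) \<Psi> (x p)"])
    show "((\<lambda>\<theta>. sin (fst (\<theta>, \<alpha>)) *\<^sub>R ddir (0, polar\<^sub>\<theta> a b c (\<theta>, \<alpha>)) \<Psi> (x (\<theta>, \<alpha>)))
      has_vector_derivative P' (\<theta>, \<alpha>)) (at \<theta> within {0..pi})" if "\<theta> \<in> {0..pi}" for \<theta> \<alpha>
      unfolding P'_def fst_conv
      by (intro has_vector_derivative_scaleR DERIV_sin has_field_derivative_at_within
          ddir_vector_field_curve[OF V xV that x\<theta>] has_vector_derivative_Pair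
          has_vector_derivative_const polar_has_vector_derivative)
    show "((\<lambda>\<alpha>. ddir (0, polar\<^sub>\<alpha> a b (\<theta>, \<alpha>)) \<Psi> (x (\<theta>, \<alpha>)))
      has_vector_derivative Q' (\<theta>, \<alpha>)) (at \<alpha> within {0..2 * pi})" if "\<alpha> \<in> {0..2*pi}" for \<theta> \<alpha>
      unfolding Q'_def m_def fst_conv snd_conv
      by (intro ddir_vector_field_curve[OF V xV that x\<alpha>] has_vector_derivative_Pair
          has_vector_derivative_const polar_has_vector_derivative)
    show "continuous_on angles P'" "continuous_on angles Q'"
      unfolding P'_def Q'_def m_def
      by (intro continuous_intros continuous_on_ddir[OF V] continuous_on_ddir_ddir[OF V] cx xV)+
  qed (auto simp: x_def polar_def polar\<^sub>\<alpha>_def)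
  moreover have "sin (fst p) *\<^sub>R (2 *\<^sub>R ddir (0, polar a b c p) \<Psi> (x p)
    - sin r *\<^sub>R (ddir (0, polar\<^sub>\<theta> a b c p) (ddir (0, polar\<^sub>\<theta> a b c p) \<Psi>) (x p)
      + ddir (0, polar\<^sub>\<alpha> a b p) (ddir (0, polar\<^sub>\<alpha> a b p) \<Psi>) (x p))) = - (P' p + Q' p)" for p
  proof -
    interpret D: linear "\<lambda>v. ddir v \<Psi> (x p)" by (rule linear_ddir[OF V xV])
    have sp: "(0::real, s *\<^sub>R v) = s *\<^sub>R (0, v)" "(0::real, - v) = - (0, v)" for s v
      by auto
    note s2 = linear_scale[OF linear_ddir[OF V(1) smooth_on_ddir[OF V(2)] xV]]
    \<comment> \<open>Turning \<open>polar\<^sub>\<alpha>\<close> yields \<open>- m p\<close>. Its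
      component along \<open>polar\<close> supplies the second half of the factor 2, and its
      component along \<open>polar\<^sub>\<theta>\<close> cancels the \<open>cos \<theta>\<close>
      term of \<open>P'\<close>.\<close>
    have "(0::real, m p) = sin (fst p) *\<^sub>R (0, polar a b c p) + cos (fst p) *\<^sub>R (0, polar\<^sub>\<theta> a b c p)"
      using rotate_back[of "fst p" "m p" c] by (simp add: m_def polar_def polar\<^sub>\<theta>_def add.commute)
    then have "ddir (0, m p) \<Psi> (x p) = sin (fst p) *\<^sub>R ddir (0, polar a b c p) \<Psi> (x p)
      + cos (fst p) *\<^sub>R ddir (0, polar\<^sub>\<theta> a b c p) \<Psi> (x p)"
      by (simp only: D.add D.scale)
    then show ?thesis
      unfolding P'_def Q'_def sp s2 D.neg by (simp add: scaleR_conv_of_real algebra_simps)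
  qed
  ultimately show ?thesis
    by (simp only: integral_neg minus_zero)
qed

lemma continuous_on_ray:
  fixes S :: "'a::t2_space set"
  assumes "continuous_on S w" "continuous_on S n" "continuous_on S t" "continuous_on S r"
    "\<And>p. p \<in> S \<Longrightarrow> \<bar>t p\<bar> < pi/2" "\<And>p. p \<in> S \<Longrightarrow> norm (great_circle (w p) (n p) (r p)) = 1"
  shows "continuous_on S (\<lambda>p. ray (w p) (n p) (t p) (r p))"
  unfolding ray_def
  by (intro continuous_intros continuous_on_ddir[OF V] continuous_on_smooth_compose[OF V(2)] assms dom)

text \<open>One differentiation under the integral along \<open>t + r = t0\<close> suffices, so the
  spherical mean itself never has to be differentiated twice. Neither sign nor size of
  \<open>r\<close> is restricted beyond keeping \<open>t0 - r\<close> in the strip: great circles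
  run through both poles.\<close>

lemma ray_mean_constant_on_cone:
  assumes o: "orthonormal4 w a b c" and r: "\<bar>t0 - r1\<bar> < pi/2" "\<bar>t0 - r2\<bar> < pi/2"
  shows "ray_mean w a b c (t0 - r1) r1 = ray_mean w a b c (t0 - r2) r2"
proof -
  let ?S = "{t0 - pi/2 <..< t0 + pi/2}"
  have S: "\<bar>t0 - r\<bar> < pi/2" if "r \<in> ?S" for r
    using that unfolding greaterThanLessThan_iff by linarith
  note po = orthonormal4_polar[OF o]
  have "((\<lambda>r. ray_mean w a b c (t0 - r) r) has_vector_derivative 0) (at r within ?S)" if r: "r \<in> ?S" for r
  proof -
    let ?x = "\<lambda>r p. (t0 - r, great_circle w (polar a b c p) r)"
    let ?f = "\<lambda>r p. sin (fst p) *\<^sub>R (2 *\<^sub>R ddir (0, polar a b c p) \<Psi> (?x r p)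
    - sin r *\<^sub>R (ddir (0, polar\<^sub>\<theta> a b c p) (ddir (0, polar\<^sub>\<theta> a b c p) \<Psi>) (?x r p)
      + ddir (0, polar\<^sub>\<alpha> a b p) (ddir (0, polar\<^sub>\<alpha> a b p) \<Psi>) (?x r p)))"
    have "((\<lambda>r. integral angles (\<lambda>p. sin (fst p) *\<^sub>R ray w (polar a b c p) (t0 - r) r)) has_vector_derivative
        integral angles (?f r)) (at r within ?S)"
    proof (rule leibniz_rule_vector_derivative)
      show "((\<lambda>r. sin (fst p) *\<^sub>R ray w (polar a b c p) (t0 - r) r) has_vector_derivative ?f r p) (at r within ?S)"
        if "r \<in> ?S" for r p
        using bounded_linear.has_vector_derivative[OF bounded_linear_scaleR_right
            ray_deriv_along_cone[OF po S that]] .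
      show "(\<lambda>p. sin (fst p) *\<^sub>R ray w (polar a b c p) (t0 - r) r) integrable_on angles" if "r \<in> ?S" for r
        by (intro integrable_continuous continuous_intros continuous_on_ray S[OF that] norm_great_circle[OF po])
      show "continuous_on (?S \<times> angles) (\<lambda>(r, p). ?f r p)"
        unfolding split_beta
        by (intro continuous_intros continuous_on_ddir[OF V] continuous_on_ddir_ddir[OF V] dom S
            norm_great_circle[OF po]) auto
    qed (use r in auto)
    then show ?thesis
      unfolding ray_mean_def cone_derivative_mean_zero[OF o S[OF r]] .
  qed
  then obtain k where "\<And>r. r \<in> ?S \<Longrightarrow> ray_mean w a b c (t0 - r) r = k"
    using has_vector_derivative_zero_constant[of ?S "\<lambda>r. ray_mean w a b c (t0 - r) r"] by blast
  moreover have "r1 \<in> ?S" "r2 \<in> ?S"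
    using r unfolding greaterThanLessThan_iff by linarith+
  ultimately show ?thesis by metis
qed


section \<open>Kirchhoff's formula, a uniform bound and the boundary limits\<close>

lemma integral_sin_angles: "integral angles (\<lambda>p. sin (fst p)) = 4 * pi"
proof -
  have "integral angles (\<lambda>p. sin (fst p)) =
    integral (cbox 0 pi) (\<lambda>x. integral (cbox 0 (2 * pi)) (\<lambda>y::real. sin x))"
    by (subst integral_prod_continuous) (auto intro!: continuous_intros)
  also have "\<dots> = integral {0..pi} (\<lambda>x. (2 * pi) * sin x)"
    by simp
  also have "\<dots> = (2 * pi) * integral {0..pi} sin"
    by (rule integral_mult_right)
  also have "integral {0..pi} sin = - cos pi - (- cos 0)"
    by (intro integral_unique fundamental_theorem_of_calculus)
      (auto intro!: derivative_eq_intros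
        simp flip: has_real_derivative_iff_has_vector_derivative)
  finally show ?thesis by simp
qed

lemma ray_mean_at_0: "ray_mean w a b c t 0 = (4 * pi) *\<^sub>R \<Psi> (t, w)"
proof -
  have "ray_mean w a b c t 0 = integral angles (\<lambda>p. sin (fst p) *\<^sub>R \<Psi> (t, w))"
    by (simp add: ray_mean_def ray_def great_circle_def)
  also have "\<dots> = integral angles (\<lambda>p. sin (fst p)) *\<^sub>R \<Psi> (t, w)"
    by (rule integral_unique[OF has_integral_scaleR_left])
      (auto intro!: integrable_integral integrable_continuous continuous_intros)
  finally show ?thesis by (simp add: integral_sin_angles)
qed

lemma ray_mean_shift:
  assumes "orthonormal4 w a b c" "\<bar>t\<bar> < pi/2"
  shows "ray_mean w a b c t r = ray_mean w a b c 0 (t + r)"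
  using ray_mean_constant_on_cone[OF assms(1), of "t + r" r "t + r"] assms(2) by simp

text \<open>The characteristic through time \<open>t\<close> at \<open>r = 0\<close> meets time 0 at
  \<open>r = t\<close>. For negative \<open>t\<close> the great circles are run backwards.\<close>

lemma kirchhoff:
  assumes "orthonormal4 w a b c" "\<bar>t\<bar> < pi/2"
  shows "(4 * pi) *\<^sub>R \<Psi> (t, w) = ray_mean w a b c 0 t"
  using ray_mean_shift[OF assms, of 0] ray_mean_at_0 by simp

text \<open>At time 0 the great circles stay in the domain of \<Psi> for every radius, so the data
  reach up to \<open>\<plusminus>pi/2\<close> and beyond.\<close>

lemma continuous_on_ray_mean:
  assumes o: "orthonormal4 w a b c"
  shows "continuous_on S (ray_mean w a b c 0)"
  unfolding ray_mean_def[abs_def]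
  by (rule integral_continuous_on_param)
    (auto simp: split_beta norm_great_circle[OF orthonormal4_polar[OF o]]
      intro!: continuous_intros continuous_on_ray)

text \<open>Kirchhoff's formula bounds the field by its data, and these range over a compact set.
  The bound is uniform in the point, as the dominated convergence argument requires.\<close>

lemma bounded_solution:
  "\<exists>B. \<forall>t y. \<bar>t\<bar> < pi/2 \<longrightarrow> norm y = 1 \<longrightarrow> norm (\<Psi> (t, y)) \<le> B"
proof -
  \<comment> \<open>All base points, unit directions and radii that the formula can use; 2 is a
    convenient bound for \<open>pi/2\<close>, and orthogonality keeps the great circles on the
    sphere.\<close>
  define K where "K = {p :: (real^4) \<times> (real^4) \<times> real. fst p \<bullet> fst p = 1 \<and>
    fst (snd p) \<bullet> fst (snd p) = 1 \<and> fst p \<bullet> fst (snd p) = 0 \<and> -2 \<le> snd (snd p) \<and> snd (snd p) \<le> 2}"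
  have "closed K"
    unfolding K_def by (intro closed_Collect_conj closed_Collect_eq closed_Collect_le continuous_intros)
  moreover have "K \<subseteq> sphere 0 1 \<times> sphere 0 1 \<times> {-2..2}"
    by (auto simp: K_def norm_eq_1)
  then have "bounded K"
    by (rule bounded_subset[rotated]) (auto intro!: bounded_Times)
  ultimately have "compact K"
    by (simp add: compact_eq_bounded_closed)
  moreover have "continuous_on K (\<lambda>p. ray (fst p) (fst (snd p)) 0 (snd (snd p)))"
  proof (rule continuous_on_ray)
    fix p assume "p \<in> K"
    then show "norm (great_circle (fst p) (fst (snd p)) (snd (snd p))) = 1"
      by (auto simp: K_def great_circle_def norm_eq_1 inner_add_left inner_add_right inner_commute)
  qed (auto intro!: continuous_intros)
  ultimately have "bounded ((\<lambda>p. ray (fst p) (fst (snd p)) 0 (snd (snd p))) ` K)"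
    using compact_continuous_image compact_imp_bounded by blast
  then obtain B where B: "B > 0" "\<And>p. p \<in> K \<Longrightarrow> norm (ray (fst p) (fst (snd p)) 0 (snd (snd p))) \<le> B"
    unfolding bounded_pos by auto
  have "norm (\<Psi> (t, w)) \<le> B * measure lborel angles" if t: "\<bar>t\<bar> < pi/2" and w: "norm w = 1" for t w
  proof -
    obtain a b c where o: "orthonormal4 w a b c"
      using orthonormal4_exists[OF w] .
    note po = orthonormal4_polar[OF o]
    have "norm (ray_mean w a b c 0 t) \<le> B * measure lborel angles"
      unfolding ray_mean_def
    proof (rule has_integral_bound)
      show "((\<lambda>p. sin (fst p) *\<^sub>R ray w (polar a b c p) 0 t) has_integral
        integral angles (\<lambda>p. sin (fst p) *\<^sub>R ray w (polar a b c p) 0 t)) angles"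
        by (intro integrable_integral integrable_continuous continuous_intros continuous_on_ray
            norm_great_circle[OF po]) auto
      show "norm (sin (fst p) *\<^sub>R ray w (polar a b c p) 0 t) \<le> B" for p
      proof -
        have "(w, polar a b c p, t) \<in> K"
          using po[of p] t pi_less_4 by (auto simp: K_def orthonormal4_def)
        then have "norm (ray w (polar a b c p) 0 t) \<le> B"
          using B(2) by force
        then have "\<bar>sin (fst p)\<bar> * norm (ray w (polar a b c p) 0 t) \<le> 1 * B"
          by (intro mult_mono) auto
        then show ?thesis by simp
      qed
    qed (use B in auto)
    moreover have "norm (\<Psi> (t, w)) \<le> 4 * pi * norm (\<Psi> (t, w))"
      using pi_gt3 by (intro mult_le_cancel_right1[THEN iffD2]) auto
    moreover have "norm (ray_mean w a b c 0 t) = 4 * pi * norm (\<Psi> (t, w))"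
      unfolding kirchhoff[OF o t, symmetric] by simp
    ultimately show ?thesis by linarith
  qed
  then show ?thesis by blast
qed

lemma ray_mean_tendsto:
  assumes "orthonormal4 w a b c"
  shows "((\<lambda>t. (4 * pi) *\<^sub>R \<Psi> (t, w)) \<longlongrightarrow> ray_mean w a b c 0 (pi/2)) (at_left (pi/2))"
    and "((\<lambda>t. (4 * pi) *\<^sub>R \<Psi> (t, w)) \<longlongrightarrow> ray_mean w a b c 0 (-pi/2)) (at_right (-pi/2))"
proof -
  have "isCont (ray_mean w a b c 0) s" for s
    using continuous_on_ray_mean[OF assms, of UNIV] by (simp add: continuous_on_eq_continuous_at)
  then have lim: "(ray_mean w a b c 0 \<longlongrightarrow> ray_mean w a b c 0 s) (at s within S)" for s S
    using continuous_at_imp_continuous_within continuous_within by blast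
  have "\<forall>\<^sub>F t in at_left (pi/2). ray_mean w a b c 0 t = (4 * pi) *\<^sub>R \<Psi> (t, w)"
    by (rule eventually_mono[OF eventually_at_left_real[of "-pi/2" "pi/2"]])
      (auto simp: kirchhoff[OF assms] abs_less_iff)
  then show "((\<lambda>t. (4 * pi) *\<^sub>R \<Psi> (t, w)) \<longlongrightarrow> ray_mean w a b c 0 (pi/2)) (at_left (pi/2))"
    by (rule Lim_transform_eventually[OF lim])
  have "\<forall>\<^sub>F t in at_right (-pi/2). ray_mean w a b c 0 t = (4 * pi) *\<^sub>R \<Psi> (t, w)"
    by (rule eventually_mono[OF eventually_at_right_real[of "-pi/2" "pi/2"]])
      (auto simp: kirchhoff[OF assms] abs_less_iff)
  then show "((\<lambda>t. (4 * pi) *\<^sub>R \<Psi> (t, w)) \<longlongrightarrow> ray_mean w a b c 0 (-pi/2)) (at_right (-pi/2))"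
    by (rule Lim_transform_eventually[OF lim])
qed

lemma boundary_limits:
  assumes "norm w = 1"
  shows "\<exists>L. ((\<lambda>t. \<Psi> (t, w)) \<longlongrightarrow> L) (at_left (pi/2))"
    and "\<exists>L. ((\<lambda>t. \<Psi> (t, w)) \<longlongrightarrow> L) (at_right (-pi/2))"
proof -
  obtain a b c where o: "orthonormal4 w a b c"
    using orthonormal4_exists[OF assms] .
  show "\<exists>L. ((\<lambda>t. \<Psi> (t, w)) \<longlongrightarrow> L) (at_left (pi/2))"
    using tendsto_scaleR[OF tendsto_const[of "1 / (4 * pi)"] ray_mean_tendsto(1)[OF o]] by auto
  show "\<exists>L. ((\<lambda>t. \<Psi> (t, w)) \<longlongrightarrow> L) (at_right (-pi/2))"
    using tendsto_scaleR[OF tendsto_const[of "1 / (4 * pi)"] ray_mean_tendsto(2)[OF o]] by auto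
qed

section \<open>Antipodal reflection of the data and uniqueness at the past boundary\<close>

lemma ray_has_vector_derivative:
  assumes o: "orthonormal4 w n b c" and s: "\<bar>t + s\<bar> < pi/2"
  shows "((\<lambda>s. sin (r + s) *\<^sub>R \<Psi> (t + s, great_circle w n (r + s)))
    has_vector_derivative ray w n (t + s) (r + s)) (at s within S)"
proof -
  have shift: "((\<lambda>s. r + s) has_vector_derivative 1) (at s within S)" for r :: real
    by (auto intro!: derivative_eq_intros simp: has_vector_derivative_def)
  have gc: "((\<lambda>s. great_circle w n (r + s)) has_vector_derivative great_circle' w n (r + s)) (at s within S)"
    using vector_diff_chain_within[OF shift great_circle_has_vector_derivative(1)]
    by (simp add: o_def)
  have sin': "((\<lambda>s. sin (r + s)) has_field_derivative cos (r + s)) (at s within S)"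
    by (auto intro!: derivative_eq_intros)
  show ?thesis
    unfolding ray_def
    by (intro has_vector_derivative_scaleR sin' ddir_curve[OF V] has_vector_derivative_Pair shift gc
        dom s norm_great_circle[OF o])
qed

text \<open>The antipodal map carries an outgoing null line to an outgoing null line traversed
  backwards and leaves the weight \<open>sin r\<close> unchanged. Parity contributes \<epsilon>, the
  reversal of direction -1. The constant \<open>c0\<close> stands for \<open>pi\<close> at the
  future boundary and for \<open>-pi\<close> at the past one.\<close>

lemma ray_reflect:
  assumes par: "\<And>t y. \<bar>t\<bar> < pi/2 \<Longrightarrow> norm y = 1 \<Longrightarrow> \<Psi> (- t, - y) = \<epsilon> *\<^sub>R \<Psi> (t, y)"
    and o: "orthonormal4 w n b c" and t: "\<bar>t\<bar> < pi/2" and c0: "cos c0 = -1" "sin c0 = 0"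
  shows "ray w n (- t) (c0 - r) = - \<epsilon> *\<^sub>R ray w (- n) t r"
proof -
  have o': "orthonormal4 w (-n) b c"
    using o by (simp add: orthonormal4_def)
  let ?S = "{t - pi/2 <..< t + pi/2}"
  have "((\<lambda>s. sin (c0 - r + s) *\<^sub>R \<Psi> (- t + s, great_circle w n (c0 - r + s)))
    has_vector_derivative ray w n (- t + 0) (c0 - r + 0)) (at 0)"
    by (rule ray_has_vector_derivative[OF o]) (use t in simp)
  moreover have "((\<lambda>s. sin (r + s) *\<^sub>R \<Psi> (t + s, great_circle w (-n) (r + s)))
    has_vector_derivative ray w (-n) (t + - 0) (r + - 0)) (at (- 0))"
    by (rule ray_has_vector_derivative[OF o']) (use t in simp)
  from vector_diff_chain_at[OF has_vector_derivative_minus[OF has_vector_derivative_id] this]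
  have "((\<lambda>s. sin (r - s) *\<^sub>R \<Psi> (t - s, great_circle w (-n) (r - s)))
    has_vector_derivative (- 1) *\<^sub>R ray w (-n) t r) (at 0)"
    by (simp add: o_def)
  then have "((\<lambda>s. \<epsilon> *\<^sub>R (sin (r - s) *\<^sub>R \<Psi> (t - s, great_circle w (-n) (r - s))))
    has_vector_derivative \<epsilon> *\<^sub>R ((- 1) *\<^sub>R ray w (-n) t r)) (at 0)"
    by (rule bounded_linear.has_vector_derivative[OF bounded_linear_scaleR_right])
  then have "((\<lambda>s. sin (c0 - r + s) *\<^sub>R \<Psi> (- t + s, great_circle w n (c0 - r + s)))
    has_vector_derivative \<epsilon> *\<^sub>R ((- 1) *\<^sub>R ray w (-n) t r)) (at 0)"
  proof (rule has_vector_derivative_transform_within_open)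
    show "open ?S" "0 \<in> ?S"
      using t by (auto simp: abs_less_iff)
    fix s assume "s \<in> ?S"
    then have ts: "\<bar>t - s\<bar> < pi/2" unfolding greaterThanLessThan_iff by linarith
    have "great_circle w n (c0 - r + s) = - great_circle w (-n) (r - s)"
      using cos_diff[of c0 "r - s"] sin_diff[of c0 "r - s"] c0
      by (simp add: great_circle_def algebra_simps)
    moreover have "sin (c0 - r + s) = sin (r - s)"
      using sin_diff[of c0 "r - s"] c0 by (simp add: algebra_simps)
    ultimately show "\<epsilon> *\<^sub>R (sin (r - s) *\<^sub>R \<Psi> (t - s, great_circle w (-n) (r - s)))
      = sin (c0 - r + s) *\<^sub>R \<Psi> (- t + s, great_circle w n (c0 - r + s))"
      using par[OF ts norm_great_circle[OF o', of "r - s"]] by simp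
  qed
  ultimately show ?thesis
    using vector_derivative_unique_at by fastforce
qed

text \<open>Reflection produces the mean over the reversed frame. Instead of a change of variables
  on the 2-sphere, both means are identified with the same value of \<Psi>.\<close>

lemma ray_mean_reflect:
  assumes par: "\<And>t y. \<bar>t\<bar> < pi/2 \<Longrightarrow> norm y = 1 \<Longrightarrow> \<Psi> (- t, - y) = \<epsilon> *\<^sub>R \<Psi> (t, y)"
    and o: "orthonormal4 w a b c" and c0: "cos c0 = -1" "sin c0 = 0" and s: "\<bar>s\<bar> \<le> pi/2"
  shows "ray_mean w a b c 0 (c0 - s) = - \<epsilon> *\<^sub>R ray_mean w a b c 0 s"
proof -
  have refl: "ray w (polar a b c p) 0 (c0 - s) = - \<epsilon> *\<^sub>R ray w (polar (-a) (-b) (-c) p) 0 s" for p s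
    using ray_reflect[OF par orthonormal4_polar[OF o] _ c0, of 0] by (simp add: polar_minus)
  have *: "ray_mean w a b c 0 (c0 - s) = - \<epsilon> *\<^sub>R ray_mean w (-a) (-b) (-c) 0 s" for s
  proof -
    have "ray_mean w a b c 0 (c0 - s) =
      integral angles (\<lambda>p. - \<epsilon> *\<^sub>R (sin (fst p) *\<^sub>R ray w (polar (-a) (-b) (-c) p) 0 s))"
      unfolding ray_mean_def by (rule integral_cong) (simp add: refl)
    also have "\<dots> = - \<epsilon> *\<^sub>R ray_mean w (-a) (-b) (-c) 0 s"
      unfolding ray_mean_def by (rule integral_cmul)
    finally show ?thesis .
  qed
  note o' = orthonormal4_minus[OF o]
  \<comment> \<open>Kirchhoff's formula covers the open interval only; continuity adds the end
    points, which are the boundary values of interest.\<close>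
  let ?f = "\<lambda>s. ray_mean w (-a) (-b) (-c) 0 s - ray_mean w a b c 0 s"
  have "?f s = 0"
  proof (rule continuous_constant_on_closure[of "{-pi/2<..<pi/2}" ?f])
    show "continuous_on (closure {-pi/2<..<pi/2}) ?f"
      by (intro continuous_intros continuous_on_ray_mean o o')
    show "?f x = 0" if "x \<in> {-pi/2<..<pi/2}" for x
    proof -
      have "\<bar>x\<bar> < pi/2"
        using that unfolding greaterThanLessThan_iff by linarith
      then show ?thesis
        by (simp flip: kirchhoff[OF o] kirchhoff[OF o'])
    qed
    show "s \<in> closure {-pi/2<..<pi/2}"
      using s by (auto simp: abs_le_iff)
  qed
  with * show ?thesis by simp
qed

text \<open>\<open>pi/2\<close> and \<open>-pi/2\<close> are the fixed points of the reflections
  \<open>pi - s\<close> and \<open>-pi - s\<close>, so the mean equals its own negative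
  there.\<close>

lemma even_imp_dirichlet_zero:
  assumes par: "\<And>t y. \<bar>t\<bar> < pi/2 \<Longrightarrow> norm y = 1 \<Longrightarrow> \<Psi> (- t, - y) = \<Psi> (t, y)"
    and w: "norm w = 1"
  shows "((\<lambda>t. \<Psi> (t, w)) \<longlongrightarrow> 0) (at_left (pi/2))"
    and "((\<lambda>t. \<Psi> (t, w)) \<longlongrightarrow> 0) (at_right (-pi/2))"
proof -
  obtain a b c where o: "orthonormal4 w a b c"
    using orthonormal4_exists[OF w] .
  have "ray_mean w a b c 0 (pi - pi/2) = - 1 *\<^sub>R ray_mean w a b c 0 (pi/2)"
    by (rule ray_mean_reflect[OF _ o]) (use par in auto)
  then have "ray_mean w a b c 0 (pi/2) = 0"
    by (simp add: eq_neg_iff_add_eq_0 flip: scaleR_2)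
  with ray_mean_tendsto(1)[OF o] show "((\<lambda>t. \<Psi> (t, w)) \<longlongrightarrow> 0) (at_left (pi/2))"
    using tendsto_scaleR[OF tendsto_const[of "1 / (4 * pi)"] ray_mean_tendsto(1)[OF o]] by simp
  have "ray_mean w a b c 0 (-pi - (-pi/2)) = - 1 *\<^sub>R ray_mean w a b c 0 (-pi/2)"
    by (rule ray_mean_reflect[OF _ o]) (use par in auto)
  then have "ray_mean w a b c 0 (-pi/2) = 0"
    by (simp add: eq_neg_iff_add_eq_0 flip: scaleR_2)
  then show "((\<lambda>t. \<Psi> (t, w)) \<longlongrightarrow> 0) (at_right (-pi/2))"
    using tendsto_scaleR[OF tendsto_const[of "1 / (4 * pi)"] ray_mean_tendsto(2)[OF o]] by simp
qed

lemma odd_dirichlet_zero_imp_zero: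
  assumes par: "\<And>t y. \<bar>t\<bar> < pi/2 \<Longrightarrow> norm y = 1 \<Longrightarrow> \<Psi> (- t, - y) = - \<Psi> (t, y)"
    and zero: "\<And>y. norm y = 1 \<Longrightarrow> ((\<lambda>t. \<Psi> (t, y)) \<longlongrightarrow> 0) (at_right (-pi/2))"
    and w: "norm w = 1" and t: "\<bar>t\<bar> < pi/2"
  shows "\<Psi> (t, w) = 0"
proof -
  obtain e\<^sub>1 e\<^sub>2 e\<^sub>3 where o: "orthonormal4 w e\<^sub>1 e\<^sub>2 e\<^sub>3"
    using orthonormal4_exists[OF w] .
  note po = orthonormal4_polar[OF o]
  obtain B where B: "\<And>t y. \<bar>t\<bar> < pi/2 \<Longrightarrow> norm y = 1 \<Longrightarrow> norm (\<Psi> (t, y)) \<le> B"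
    using bounded_solution by blast
  define G where "G = ray_mean w e\<^sub>1 e\<^sub>2 e\<^sub>3 0"
  \<comment> \<open>Large enough for all arguments of \<open>\<Gamma>\<close> below, which lie
    between \<open>-3*pi/2\<close> and \<open>pi/2\<close>.\<close>
  let ?I = "{-2*pi..2*pi}"
  have "continuous_on ?I G"
    unfolding G_def by (rule continuous_on_ray_mean[OF o])
  then have "\<exists>\<Gamma>. \<forall>x\<in>?I. (\<Gamma> has_vector_derivative G x) (at x within ?I)"
    by (rule antiderivative_continuous) blast
  then obtain \<Gamma> where \<Gamma>: "\<And>x. x \<in> ?I \<Longrightarrow> (\<Gamma> has_vector_derivative G x) (at x within ?I)"
    by blast
  have \<Gamma>_at: "(\<Gamma> has_vector_derivative G x) (at x)" if "\<bar>x\<bar> < 2*pi" for x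
  proof -
    have "x \<in> interior ?I" using that by (auto simp: abs_less_iff)
    then show ?thesis
      using \<Gamma>[of x] at_within_interior[of x ?I] interior_subset by auto
  qed
  define U where "U t r = integral angles (\<lambda>p. sin (fst p) *\<^sub>R (sin r *\<^sub>R \<Psi> (t, great_circle w (polar e\<^sub>1 e\<^sub>2 e\<^sub>3 p) r)))" for t r
  \<comment> \<open>The outgoing null line from radius \<open>-\<rho>\<close> reaches
    \<open>r = 0\<close>, where \<open>U\<close> vanishes, at the later time
    \<open>t + \<rho>\<close>. From radius \<open>\<rho>\<close> it would have to be followed into
    the past and would leave the strip when \<open>t\<close> is near \<open>-pi/2\<close>.\<close>
  have U_eq: "U t (-\<rho>) = (1/2) *\<^sub>R (\<Gamma> (t - \<rho>) - \<Gamma> (t + \<rho>))"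
    if \<rho>: "\<rho> > 0" and t: "\<bar>t\<bar> < pi/2" "t + \<rho> < pi/2" for t \<rho>
  proof -
    have ts: "\<bar>t + s\<bar> < pi/2" if "s \<in> {0..\<rho>}" for s
      using that \<rho> t unfolding atLeastAtMost_iff by linarith
    have x: "\<bar>t - \<rho> + 2 * s\<bar> < 2*pi" if "s \<in> {0..\<rho>}" for s
      using that \<rho> t pi_gt_zero unfolding atLeastAtMost_iff by linarith
    have "((\<lambda>s. U (t + s) (- \<rho> + s) - (1/2) *\<^sub>R \<Gamma> (t - \<rho> + 2 * s)) has_vector_derivative 0) (at s within {0..\<rho>})"
      if s: "s \<in> {0..\<rho>}" for s
    proof -
      have "((\<lambda>s. U (t + s) (- \<rho> + s)) has_vector_derivative ray_mean w e\<^sub>1 e\<^sub>2 e\<^sub>3 (t + s) (- \<rho> + s))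
        (at s within {0..\<rho>})"
        unfolding U_def ray_mean_def
      proof (rule leibniz_rule_vector_derivative)
        show "((\<lambda>s. sin (fst p) *\<^sub>R (sin (- \<rho> + s) *\<^sub>R \<Psi> (t + s, great_circle w (polar e\<^sub>1 e\<^sub>2 e\<^sub>3 p) (- \<rho> + s))))
          has_vector_derivative sin (fst p) *\<^sub>R ray w (polar e\<^sub>1 e\<^sub>2 e\<^sub>3 p) (t + s) (- \<rho> + s)) (at s within {0..\<rho>})"
          if "s \<in> {0..\<rho>}" for s p
          using bounded_linear.has_vector_derivative[OF bounded_linear_scaleR_right
              ray_has_vector_derivative[OF po ts[OF that]]] .
        show "(\<lambda>p. sin (fst p) *\<^sub>R (sin (- \<rho> + s) *\<^sub>R \<Psi> (t + s, great_circle w (polar e\<^sub>1 e\<^sub>2 e\<^sub>3 p) (- \<rho> + s))))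
          integrable_on angles" if "s \<in> {0..\<rho>}" for s
          by (intro integrable_continuous continuous_intros continuous_on_smooth_compose[OF V(2)] dom
              ts[OF that] norm_great_circle[OF po])
        show "continuous_on ({0..\<rho>} \<times> angles)
          (\<lambda>(s, p). sin (fst p) *\<^sub>R ray w (polar e\<^sub>1 e\<^sub>2 e\<^sub>3 p) (t + s) (- \<rho> + s))"
          unfolding split_beta
          by (intro continuous_intros continuous_on_ray ts norm_great_circle[OF po]) auto
      qed (use s in auto)
      moreover have "ray_mean w e\<^sub>1 e\<^sub>2 e\<^sub>3 (t + s) (- \<rho> + s) = G (t - \<rho> + 2 * s)"
        using ray_mean_shift[OF o ts[OF s], of "- \<rho> + s"] by (simp add: G_def algebra_simps)
      moreover have "((\<lambda>s. t - \<rho> + 2 * s) has_vector_derivative 2) (at s within {0..\<rho>})"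
        by (auto intro!: derivative_eq_intros simp: has_vector_derivative_def)
      then have "(\<Gamma> \<circ> (\<lambda>s. t - \<rho> + 2 * s) has_vector_derivative 2 *\<^sub>R G (t - \<rho> + 2 * s)) (at s within {0..\<rho>})"
        by (rule vector_diff_chain_within) (rule has_vector_derivative_at_within[OF \<Gamma>_at[OF x[OF s]]])
      then have "((\<lambda>s. (1/2) *\<^sub>R \<Gamma> (t - \<rho> + 2 * s)) has_vector_derivative (1/2) *\<^sub>R (2 *\<^sub>R G (t - \<rho> + 2 * s)))
        (at s within {0..\<rho>})"
        unfolding o_def by (rule bounded_linear.has_vector_derivative[OF bounded_linear_scaleR_right])
      ultimately show ?thesis
        using has_vector_derivative_diff by fastforce
    qed
    then obtain k where k: "\<And>s. s \<in> {0..\<rho>} \<Longrightarrow> U (t + s) (- \<rho> + s) - (1/2) *\<^sub>R \<Gamma> (t - \<rho> + 2 * s) = k"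
      using has_vector_derivative_zero_constant[of "{0..\<rho>}" "\<lambda>s. U (t + s) (- \<rho> + s) - (1/2) *\<^sub>R \<Gamma> (t - \<rho> + 2 * s)"] by blast
    have "U (t + \<rho>) 0 = 0"
      by (simp add: U_def)
    then have "- ((1/2) *\<^sub>R \<Gamma> (t + \<rho>)) = k"
      using k[of \<rho>] \<rho> by (simp add: add.commute)
    then show ?thesis
      using k[of 0] \<rho> by (auto simp: scaleR_diff_right diff_eq_eq)
  qed
  have \<Gamma>_eq: "\<Gamma> (-pi/2 - \<rho>) = \<Gamma> (-pi/2 + \<rho>)" if \<rho>: "\<rho> \<in> {0<..<pi}" for \<rho>
  proof -
    \<comment> \<open>A divisor of at least 2 keeps \<open>t k\<close> strictly below
      \<open>pi/2 - \<rho>\<close>, as \<open>U_eq\<close> demands.\<close>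
    define t where "t k = -pi/2 + (pi - \<rho>) / real (k + 2)" for k
    have tk: "- pi/2 < t k" "t k < pi/2 - \<rho>" for k
    proof -
      have "(pi - \<rho>) / real (k + 2) < (pi - \<rho>) / 1"
        using \<rho> by (intro divide_strict_left_mono) auto
      moreover have "0 < (pi - \<rho>) / real (k + 2)"
        using \<rho> by simp
      ultimately show "- pi/2 < t k" "t k < pi/2 - \<rho>"
        by (auto simp: t_def)
    qed
    have tk': "\<bar>t k\<bar> < pi/2" for k
      using tk[of k] \<rho> unfolding greaterThanLessThan_iff by linarith
    have "(\<lambda>k. (pi - \<rho>) / real (k + 2)) \<longlonglongrightarrow> 0"
      using LIMSEQ_ignore_initial_segment[OF lim_const_over_n[of "pi - \<rho>"], of 2] by simp
    then have t_lim: "t \<longlonglongrightarrow> - pi/2"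
      unfolding t_def[abs_def] using tendsto_add[OF tendsto_const[of "-pi/2"]] by fastforce
    then have t_right: "filterlim t (at_right (- pi/2)) sequentially"
      using tk(1) by (auto simp: filterlim_at eventually_sequentially less_imp_neq[THEN not_sym] intro!: always_eventually)
    \<comment> \<open>The Dirichlet limits hold in each direction separately, without uniformity;
      \<open>B\<close> dominates.\<close>
    have "(\<lambda>k. U (t k) (-\<rho>)) \<longlonglongrightarrow> integral angles (\<lambda>p. 0)"
      unfolding U_def
    proof (rule dominated_convergence)
      show "(\<lambda>p. sin (fst p) *\<^sub>R (sin (- \<rho>) *\<^sub>R \<Psi> (t k, great_circle w (polar e\<^sub>1 e\<^sub>2 e\<^sub>3 p) (- \<rho>))))
        integrable_on angles" for k
        by (intro integrable_continuous continuous_intros continuous_on_smooth_compose[OF V(2)] dom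
            tk' norm_great_circle[OF po])
      show "(\<lambda>p. B) integrable_on angles"
        by (rule integrable_const)
      show "norm (sin (fst p) *\<^sub>R (sin (- \<rho>) *\<^sub>R \<Psi> (t k, great_circle w (polar e\<^sub>1 e\<^sub>2 e\<^sub>3 p) (- \<rho>)))) \<le> B" for k p
      proof -
        have "\<bar>sin (fst p)\<bar> * (\<bar>sin (- \<rho>)\<bar> * norm (\<Psi> (t k, great_circle w (polar e\<^sub>1 e\<^sub>2 e\<^sub>3 p) (- \<rho>)))) \<le> 1 * (1 * B)"
          by (intro mult_mono B tk' norm_great_circle[OF po]) auto
        then show ?thesis by (simp add: abs_mult mult.assoc)
      qed
      fix p
      have "(\<lambda>k. \<Psi> (t k, great_circle w (polar e\<^sub>1 e\<^sub>2 e\<^sub>3 p) (- \<rho>))) \<longlonglongrightarrow> 0"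
        using filterlim_compose[OF zero[OF norm_great_circle[OF po]] t_right] .
      then have "(\<lambda>k. sin (fst p) *\<^sub>R (sin (- \<rho>) *\<^sub>R \<Psi> (t k, great_circle w (polar e\<^sub>1 e\<^sub>2 e\<^sub>3 p) (- \<rho>))))
        \<longlonglongrightarrow> sin (fst p) *\<^sub>R (sin (- \<rho>) *\<^sub>R 0)"
        by (intro tendsto_scaleR tendsto_const)
      then show "(\<lambda>k. sin (fst p) *\<^sub>R (sin (- \<rho>) *\<^sub>R \<Psi> (t k, great_circle w (polar e\<^sub>1 e\<^sub>2 e\<^sub>3 p) (- \<rho>)))) \<longlonglongrightarrow> 0"
        by simp
    qed
    then have "(\<lambda>k. (1/2) *\<^sub>R (\<Gamma> (t k - \<rho>) - \<Gamma> (t k + \<rho>))) \<longlonglongrightarrow> 0"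
      using U_eq[of \<rho>] \<rho> tk tk' by (simp add: less_diff_eq)
    moreover have "(\<lambda>k. \<Gamma> (t k + s)) \<longlonglongrightarrow> \<Gamma> (-pi/2 + s)" if "\<bar>s\<bar> < pi" for s
    proof (rule isCont_tendsto_compose[where g = \<Gamma>])
      have "\<bar>-pi/2 + s\<bar> < 2 * pi" using that pi_gt_zero by linarith
      then show "isCont \<Gamma> (-pi/2 + s)"
        using \<Gamma>_at has_vector_derivative_continuous by blast
      show "(\<lambda>k. t k + s) \<longlonglongrightarrow> -pi/2 + s"
        by (intro tendsto_add t_lim tendsto_const)
    qed
    from this[of "-\<rho>"] this[of \<rho>]
    have "(\<lambda>k. (1/2) *\<^sub>R (\<Gamma> (t k - \<rho>) - \<Gamma> (t k + \<rho>))) \<longlonglongrightarrow> (1/2) *\<^sub>R (\<Gamma> (-pi/2 - \<rho>) - \<Gamma> (-pi/2 + \<rho>))"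
      using \<rho> by (intro tendsto_scaleR tendsto_const tendsto_diff) auto
    ultimately show ?thesis
      using LIMSEQ_unique by fastforce
  qed
  define \<rho> where "\<rho> = t + pi/2"
  have \<rho>: "\<rho> \<in> {0<..<pi}"
    using t unfolding \<rho>_def greaterThanLessThan_iff by linarith
  have a: "((\<lambda>x. -pi/2 - x) has_vector_derivative -1) (at \<rho>)" "((\<lambda>x. -pi/2 + x) has_vector_derivative 1) (at \<rho>)"
    by (auto intro!: derivative_eq_intros simp: has_vector_derivative_def)
  have b: "\<bar>-pi/2 - \<rho>\<bar> < 2 * pi" "\<bar>-pi/2 + \<rho>\<bar> < 2 * pi"
    using \<rho> unfolding greaterThanLessThan_iff by linarith+
  note d = vector_diff_chain_at[OF a(1) \<Gamma>_at[OF b(1)]] vector_diff_chain_at[OF a(2) \<Gamma>_at[OF b(2)]]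
  \<comment> \<open>Differentiating \<open>\<Gamma>_eq\<close> in \<rho> turns it into antisymmetry
    of \<open>G\<close> about \<open>-pi/2\<close>.\<close>
  have "(\<Gamma> \<circ> (\<lambda>x. -pi/2 - x) has_vector_derivative 1 *\<^sub>R G (-pi/2 + \<rho>)) (at \<rho>)"
    by (rule has_vector_derivative_transform_within_open[OF d(2) _ \<rho>]) (use \<Gamma>_eq in auto)
  with d(1) have "-1 *\<^sub>R G (-pi/2 - \<rho>) = 1 *\<^sub>R G (-pi/2 + \<rho>)"
    by (rule vector_derivative_unique_at)
  moreover have shift: "-pi/2 - \<rho> = - pi - t" "-pi/2 + \<rho> = t"
    by (simp_all add: \<rho>_def)
  ultimately have "- G (- pi - t) = G t"
    unfolding shift by simp
  \<comment> \<open>With \<epsilon> = -1, parity makes \<open>G\<close> symmetric about the same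
    point.\<close>
  moreover have "G (- pi - t) = - (-1) *\<^sub>R G t"
    unfolding G_def by (rule ray_mean_reflect[OF _ o]) (use par t in auto)
  ultimately have "G t = - G t"
    by simp
  then have "G t = 0"
    by (simp add: eq_neg_iff_add_eq_0 flip: scaleR_2)
  then show ?thesis
    using kirchhoff[OF o t] by (simp add: G_def)
qed

text \<open>The cylinder is static: the coefficients of the equation depend on \<open>y\<close> but
  not on \<open>t\<close>, so it may be differentiated in time at fixed \<open>y\<close>.\<close>

lemma time_derivative: "cylinder_wave (ddir (1, 0) \<Psi>) V"
proof
  fix t y assume t: "\<bar>t::real\<bar> < pi/2" and y: "norm (y::real^4) = 1"
  let ?e = "(1, 0) :: pt"
  let ?S = "{- pi/2 <..< pi/2}"
  have curve: "((\<lambda>s. (s, y)) has_vector_derivative ?e) (at t)"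
    by (intro has_vector_derivative_Pair has_vector_derivative_id has_vector_derivative_const)
  have d: "((\<lambda>s. F (s, y)) has_vector_derivative ddir ?e F (t, y)) (at t)" if "smooth_on V F" for F
    by (rule ddir_curve[OF V(1) that dom[OF t y] curve])
  have comm: "ddir ?e (ddir (0, u) (ddir (0, u) \<Psi>)) (t, y) = ddir (0, u) (ddir (0, u) (ddir ?e \<Psi>)) (t, y)" for u
  proof -
    let ?v = "(0, u) :: pt"
    have "ddir ?e (ddir ?v (ddir ?v \<Psi>)) (t, y) = ddir ?v (ddir ?e (ddir ?v \<Psi>)) (t, y)"
      by (intro ddir_commute[OF V(1)] smooth_on_ddir V dom t y)
    also have "\<dots> = ddir ?v (ddir ?v (ddir ?e \<Psi>)) (t, y)"
      by (rule ddir_cong_open[OF V(1) dom[OF t y] ddir_commute[OF V]])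
        (auto intro!: has_derivative_ddir[OF V(1)] smooth_on_ddir V dom t y)
    finally show ?thesis .
  qed
  have "((\<lambda>s. (\<Sum>b\<in>Basis. ddir (0, b) (ddir (0, b) \<Psi>) (s, y)) - ddir (0, y) (ddir (0, y) \<Psi>) (s, y)
      - 3 *\<^sub>R ddir (0, y) \<Psi> (s, y) - \<Psi> (s, y)) has_vector_derivative
    (\<Sum>b\<in>Basis. ddir ?e (ddir (0, b) (ddir (0, b) \<Psi>)) (t, y)) - ddir ?e (ddir (0, y) (ddir (0, y) \<Psi>)) (t, y)
      - 3 *\<^sub>R ddir ?e (ddir (0, y) \<Psi>) (t, y) - ddir ?e \<Psi> (t, y)) (at t)"
    by (intro has_vector_derivative_diff has_vector_derivative_sum d smooth_on_ddir V
        bounded_linear.has_vector_derivative[OF bounded_linear_scaleR_right])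
  then have "((\<lambda>s. ddir ?e (ddir ?e \<Psi>) (s, y)) has_vector_derivative
    (\<Sum>b\<in>Basis. ddir ?e (ddir (0, b) (ddir (0, b) \<Psi>)) (t, y)) - ddir ?e (ddir (0, y) (ddir (0, y) \<Psi>)) (t, y)
      - 3 *\<^sub>R ddir ?e (ddir (0, y) \<Psi>) (t, y) - ddir ?e \<Psi> (t, y)) (at t)"
  proof (rule has_vector_derivative_transform_within_open[of _ _ _ ?S])
    show "t \<in> ?S" using t unfolding greaterThanLessThan_iff by linarith
    fix s assume "s \<in> ?S"
    then have "\<bar>s\<bar> < pi/2" unfolding greaterThanLessThan_iff by linarith
    from wave[OF this y, symmetric]
    show "(\<Sum>b\<in>Basis. ddir (0, b) (ddir (0, b) \<Psi>) (s, y)) - ddir (0, y) (ddir (0, y) \<Psi>) (s, y)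
      - 3 *\<^sub>R ddir (0, y) \<Psi> (s, y) - \<Psi> (s, y) = ddir ?e (ddir ?e \<Psi>) (s, y)" .
  qed simp
  from vector_derivative_unique_at[OF d[OF smooth_on_ddir[OF smooth_on_ddir[OF V(2)]]] this]
  show "ddir ?e (ddir ?e (ddir ?e \<Psi>)) (t, y) =
    (\<Sum>b\<in>Basis. ddir (0, b) (ddir (0, b) (ddir ?e \<Psi>)) (t, y)) - ddir (0, y) (ddir (0, y) (ddir ?e \<Psi>)) (t, y)
      - 3 *\<^sub>R ddir (0, y) (ddir ?e \<Psi>) (t, y) - ddir ?e \<Psi> (t, y)"
    using ddir_commute[OF V dom[OF t y], of ?e "(0, y)"] by (simp add: comm)
qed (use V dom smooth_on_ddir in auto)

lemma time_derivative_parity: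
  assumes par: "\<And>t y. \<bar>t\<bar> < pi/2 \<Longrightarrow> norm y = 1 \<Longrightarrow> \<Psi> (- t, - y) = \<epsilon> *\<^sub>R \<Psi> (t, y)"
    and t: "\<bar>t\<bar> < pi/2" and y: "norm y = 1"
  shows "ddir (1, 0) \<Psi> (- t, - y) = - \<epsilon> *\<^sub>R ddir (1, 0) \<Psi> (t, y)"
proof -
  let ?S = "{- pi/2 <..< pi/2}"
  have tS: "t \<in> ?S" using t unfolding greaterThanLessThan_iff by linarith
  have dm: "(- t, - y) \<in> V" using dom t y by simp
  have c1: "((\<lambda>s. (- s, - y)) has_vector_derivative - (1, 0)) (at t)"
    unfolding uminus_prod_def fst_conv snd_conv minus_zero
    by (intro has_vector_derivative_Pair has_vector_derivative_minus has_vector_derivative_id has_vector_derivative_const)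
  have c2: "((\<lambda>s. (s, y)) has_vector_derivative (1, 0)) (at t)"
    by (intro has_vector_derivative_Pair has_vector_derivative_id has_vector_derivative_const)
  have "((\<lambda>s. \<epsilon> *\<^sub>R \<Psi> (s, y)) has_vector_derivative \<epsilon> *\<^sub>R ddir (1, 0) \<Psi> (t, y)) (at t)"
    by (intro bounded_linear.has_vector_derivative[OF bounded_linear_scaleR_right]
        ddir_curve[OF V dom[OF t y] c2])
  then have "((\<lambda>s. \<Psi> (- s, - y)) has_vector_derivative \<epsilon> *\<^sub>R ddir (1, 0) \<Psi> (t, y)) (at t)"
  proof (rule has_vector_derivative_transform_within_open[OF _ _ tS])
    fix s assume "s \<in> ?S"
    then have "\<bar>s\<bar> < pi/2" unfolding greaterThanLessThan_iff by linarith
    then show "\<epsilon> *\<^sub>R \<Psi> (s, y) = \<Psi> (- s, - y)" using par y by simp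
  qed simp
  moreover have "((\<lambda>s. \<Psi> (- s, - y)) has_vector_derivative ddir (- (1, 0)) \<Psi> (- t, - y)) (at t)"
    by (rule ddir_curve[OF V dm c1])
  moreover have "ddir (- (1, 0)) \<Psi> (- t, - y) = - ddir (1, 0) \<Psi> (- t, - y)"
    by (rule linear_neg[OF linear_ddir[OF V dm]])
  ultimately have "\<epsilon> *\<^sub>R ddir (1, 0) \<Psi> (t, y) = - ddir (1, 0) \<Psi> (- t, - y)"
    using vector_derivative_unique_at by metis
  then show ?thesis by simp
qed

end

section \<open>Conformal rescaling of de Sitter solutions\<close>

text \<open>Defined off the unit sphere too, because the sphere Laplacian is expressed by ambient
  derivatives, including those along the position vector.\<close>

definition conf :: "pt \<Rightarrow> pt" where
  "conf p = (tan (fst p), (1 / cos (fst p)) *\<^sub>R snd p)"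

definition conf' :: "pt \<Rightarrow> pt \<Rightarrow> pt" where
  "conf' p v = ((1 / cos (fst p))\<^sup>2 * fst v,
    (1 / cos (fst p) * tan (fst p) * fst v) *\<^sub>R snd p + (1 / cos (fst p)) *\<^sub>R snd v)"

definition strip :: "pt set \<Rightarrow> pt set" where
  "strip U = {p. \<bar>fst p\<bar> < pi/2 \<and> conf p \<in> U}"

definition cyl :: "(pt \<Rightarrow> complex) \<Rightarrow> pt \<Rightarrow> complex" where
  "cyl F p = (1 / cos (fst p)) *\<^sub>R F (conf p)"

lemma cos_pos_strip: "\<bar>t\<bar> < pi/2 \<Longrightarrow> cos t > 0"
  by (rule cos_gt_zero_pi) (auto simp: abs_less_iff)

lemma cos_nonzero_strip: "p \<in> strip U \<Longrightarrow> cos (fst p) \<noteq> 0"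
  using cos_pos_strip[of "fst p"] by (auto simp: strip_def)

lemma DERIV_sec:
  assumes "cos t \<noteq> 0"
  shows "((\<lambda>t. 1 / cos t) has_real_derivative 1 / cos t * tan t) (at t within S)"
  by (rule derivative_eq_intros refl assms)+ (use assms in \<open>simp add: tan_def field_simps\<close>)

lemma DERIV_tan_sec:
  assumes "cos t \<noteq> 0"
  shows "(tan has_real_derivative (1 / cos t)\<^sup>2) (at t within S)"
  using DERIV_tan[OF assms] by (simp add: has_field_derivative_at_within field_simps)

lemma sec_squared: "cos t \<noteq> 0 \<Longrightarrow> (1 / cos t)\<^sup>2 = 1 + (tan t)\<^sup>2" for t :: real
  using sin_cos_squared_add[of t] by (simp add: tan_def field_simps)

lemma tan_fst_has_derivative:
  assumes "cos (fst p) \<noteq> 0"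
  shows "((\<lambda>p::pt. tan (fst p)) has_derivative (\<lambda>v. (1 / cos (fst p))\<^sup>2 * fst v)) (at p)"
  using has_derivative_compose[OF has_derivative_fst[OF has_derivative_ident]
      DERIV_tan_sec[OF assms, unfolded has_field_derivative_def]] by (simp add: o_def)

lemma sec_fst_has_derivative:
  assumes "cos (fst p) \<noteq> 0"
  shows "((\<lambda>p::pt. 1 / cos (fst p)) has_derivative (\<lambda>v. 1 / cos (fst p) * tan (fst p) * fst v)) (at p)"
  using has_derivative_compose[OF has_derivative_fst[OF has_derivative_ident]
      DERIV_sec[OF assms, unfolded has_field_derivative_def]] by (simp add: o_def)

lemma conf_has_derivative:
  assumes "cos (fst p) \<noteq> 0"
  shows "(conf has_derivative conf' p) (at p)"
  unfolding conf_def[abs_def] conf'_def[abs_def]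
  using has_derivative_Pair[OF tan_fst_has_derivative[OF assms]
      has_derivative_scaleR[OF sec_fst_has_derivative[OF assms] has_derivative_snd[OF has_derivative_ident]]]
  by (simp add: add.commute)

lemma open_strip:
  assumes "open U"
  shows "open (strip U)"
proof -
  let ?A = "{p::pt. \<bar>fst p\<bar> < pi/2}"
  have A: "open ?A"
    by (intro open_Collect_less continuous_intros)
  have "continuous_on ?A conf"
    by (intro continuous_at_imp_continuous_on ballI has_derivative_continuous[OF conf_has_derivative])
      (use cos_pos_strip in force)
  from continuous_open_preimage[OF this A assms] show ?thesis
    by (simp add: strip_def Collect_conj_eq vimage_def)
qed

lemma conf_mem_dS4:
  assumes "\<bar>t\<bar> < pi/2" "norm y = 1"
  shows "conf (t, y) \<in> dS4"
proof -
  have c: "cos t \<noteq> 0" using cos_pos_strip[OF assms(1)] by simp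
  have "y \<bullet> y = 1" using assms(2) by (simp add: norm_eq_1)
  then have "mink (conf (t, y)) (conf (t, y)) = (1 / cos t)\<^sup>2 - (tan t)\<^sup>2"
    by (simp add: mink_def conf_def power2_eq_square)
  then show ?thesis
    using sec_squared[OF c] by (simp add: dS4_def)
qed

lemma ddir_conf:
  assumes U: "open U" "smooth_on U G" and p: "p \<in> strip U"
    and f: "(f has_real_derivative f') (at (fst p))"
  shows "((\<lambda>p. f (fst p) *\<^sub>R G (conf p)) has_derivative
      (\<lambda>v. f (fst p) *\<^sub>R ddir (conf' p v) G (conf p) + (f' * fst v) *\<^sub>R G (conf p))) (at p)"
proof -
  have c: "cos (fst p) \<noteq> 0" and pU: "conf p \<in> U"
    using p cos_pos_strip[of "fst p"] by (auto simp: strip_def)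
  have "(G \<circ> conf has_derivative (\<lambda>v. ddir v G (conf p)) \<circ> conf' p) (at p)"
    by (rule diff_chain_at[OF conf_has_derivative[OF c] has_derivative_ddir[OF U pU]])
  moreover have "((\<lambda>p. f (fst p)) has_derivative (\<lambda>v. f' * fst v)) (at p)"
    using has_derivative_compose[OF has_derivative_fst[OF has_derivative_ident]
        f[unfolded has_field_derivative_def]] by (simp add: o_def)
  ultimately show ?thesis
    using has_derivative_scaleR by (simp add: o_def)
qed

text \<open>A class of functions that contains \<open>cyl F\<close> and is closed under directional derivatives, so that
  \<open>smooth_on_coinduct\<close> applies to it.\<close>

inductive lifted :: "(pt \<Rightarrow> complex) \<Rightarrow> (pt \<Rightarrow> complex) \<Rightarrow> bool" for F where
  lifted_base: "lifted F (\<lambda>p. ddirs vs F (conf p))"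
| lifted_tan: "lifted F (\<lambda>p. of_real (tan (fst p)))"
| lifted_sec: "lifted F (\<lambda>p. of_real (1 / cos (fst p)))"
| lifted_coord: "lifted F (\<lambda>p. of_real (snd p \<bullet> b))"
| lifted_const: "lifted F (\<lambda>p. c)"
| lifted_add: "lifted F g \<Longrightarrow> lifted F h \<Longrightarrow> lifted F (\<lambda>p. g p + h p)"
| lifted_mult: "lifted F g \<Longrightarrow> lifted F h \<Longrightarrow> lifted F (\<lambda>p. g p * h p)"

lemma lifted_sum:
  "finite A \<Longrightarrow> (\<And>a. a \<in> A \<Longrightarrow> lifted F (g a)) \<Longrightarrow> lifted F (\<lambda>p. \<Sum>a\<in>A. g a p)"
  by (induction A rule: finite_induct) (auto intro: lifted_const lifted_add)

text \<open>The generators are closed under differentiation: \<open>tan' = sec^2\<close>,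
  \<open>sec' = sec * tan\<close>, and the Jacobian of \<open>conf\<close> is a polynomial in
  \<open>tan\<close>, \<open>sec\<close> and the spatial coordinates.\<close>

lemma lifted_differentiable:
  assumes U: "open U" "smooth_on U F" and "lifted F g"
  shows "\<exists>g'. (\<forall>p\<in>strip U. (g has_derivative (\<lambda>v. g' v p)) (at p)) \<and> (\<forall>v. lifted F (g' v))"
  using assms(3)
proof induction
  case (lifted_base vs)
  have G: "smooth_on U (ddirs vs F)" for vs
    by (induction vs) (auto intro: smooth_on_ddir U)
  let ?g' = "\<lambda>v p. \<Sum>b\<in>Basis. of_real (conf' p v \<bullet> b) * ddirs (b # vs) F (conf p)"
  have "((\<lambda>p. ddirs vs F (conf p)) has_derivative (\<lambda>v. ?g' v p)) (at p)" if p: "p \<in> strip U" for p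
  proof -
    have pU: "conf p \<in> U" using p by (simp add: strip_def)
    have "ddir (conf' p v) (ddirs vs F) (conf p) = ?g' v p" for v
      unfolding ddir_expand[OF U(1) G pU, of "conf' p v"] by (simp add: scaleR_conv_of_real)
    moreover have "((\<lambda>p. ddirs vs F (conf p)) has_derivative
      (\<lambda>v. ddir (conf' p v) (ddirs vs F) (conf p))) (at p)"
      using ddir_conf[OF U(1) G p, of "\<lambda>_. 1" 0] by simp
    ultimately show ?thesis by simp
  qed
  moreover have "lifted F (?g' v)" for v
  proof (rule lifted_sum)
    fix b :: pt
    have "conf' p v \<bullet> b = 1 / cos (fst p) * ((1 / cos (fst p)) * (fst v * fst b)
      + (tan (fst p) * fst v) * (snd p \<bullet> snd b) + snd v \<bullet> snd b)" for p
      by (simp add: conf'_def inner_prod_def inner_add_left power2_eq_square algebra_simps)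
    then have *: "(\<lambda>p. of_real (conf' p v \<bullet> b) * ddirs (b # vs) F (conf p)) =
      (\<lambda>p. (of_real (1 / cos (fst p)) * (of_real (1 / cos (fst p)) * of_real (fst v * fst b)
      + (of_real (tan (fst p)) * of_real (fst v)) * of_real (snd p \<bullet> snd b) + of_real (snd v \<bullet> snd b)))
        * ddirs (b # vs) F (conf p))"
      by (simp only: of_real_mult of_real_add)
    show "lifted F (\<lambda>p. of_real (conf' p v \<bullet> b) * ddirs (b # vs) F (conf p))"
      unfolding * by (intro lifted.intros)
  qed simp
  ultimately show ?case
    by (intro exI[of _ ?g'] conjI ballI allI)
next
  case lifted_tan
  let ?g' = "\<lambda>v p. of_real (1 / cos (fst p)) * of_real (1 / cos (fst p)) * complex_of_real (fst v)"
  have "((\<lambda>p. complex_of_real (tan (fst p))) has_derivative (\<lambda>v. ?g' v p)) (at p)" if "p \<in> strip U" for p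
  proof -
    have "((\<lambda>p. complex_of_real (tan (fst p))) has_derivative
      (\<lambda>v. complex_of_real ((1 / cos (fst p))\<^sup>2 * fst v))) (at p)"
      by (rule has_derivative_of_real[OF tan_fst_has_derivative[OF cos_nonzero_strip[OF that]]])
    then show ?thesis by (simp add: power2_eq_square)
  qed
  moreover have "lifted F (?g' v)" for v
    by (intro lifted.intros)
  ultimately show ?case
    by (intro exI[of _ ?g'] conjI ballI allI)
next
  case lifted_sec
  let ?g' = "\<lambda>v p. of_real (1 / cos (fst p)) * of_real (tan (fst p)) * complex_of_real (fst v)"
  have "((\<lambda>p. complex_of_real (1 / cos (fst p))) has_derivative (\<lambda>v. ?g' v p)) (at p)" if "p \<in> strip U" for p
  proof -
    have "((\<lambda>p. complex_of_real (1 / cos (fst p))) has_derivative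
      (\<lambda>v. complex_of_real (1 / cos (fst p) * tan (fst p) * fst v))) (at p)"
      by (rule has_derivative_of_real[OF sec_fst_has_derivative[OF cos_nonzero_strip[OF that]]])
    then show ?thesis by simp
  qed
  moreover have "lifted F (?g' v)" for v
    by (intro lifted.intros)
  ultimately show ?case
    by (intro exI[of _ ?g'] conjI ballI allI)
next
  case (lifted_coord b)
  have "((\<lambda>p. complex_of_real (snd p \<bullet> b)) has_derivative (\<lambda>v. complex_of_real (snd v \<bullet> b))) (at p)" for p :: pt
    by (auto intro!: derivative_eq_intros)
  then show ?case
    by (intro exI[of _ "\<lambda>v p. complex_of_real (snd v \<bullet> b)"]) (simp add: lifted_const)
next
  case (lifted_const c)
  have "((\<lambda>p. c) has_derivative (\<lambda>v. 0)) (at p)" for p :: pt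
    by simp
  then show ?case
    by (intro exI[of _ "\<lambda>v p. 0"]) (simp add: lifted.lifted_const)
next
  case (lifted_add g h)
  then obtain g' h' where d: "\<forall>p\<in>strip U. (g has_derivative (\<lambda>v. g' v p)) (at p)"
    "\<forall>p\<in>strip U. (h has_derivative (\<lambda>v. h' v p)) (at p)"
    and l: "\<And>v. lifted F (g' v)" "\<And>v. lifted F (h' v)" by metis
  have "\<forall>p\<in>strip U. ((\<lambda>p. g p + h p) has_derivative (\<lambda>v. g' v p + h' v p)) (at p)"
    using d by (auto intro: has_derivative_add)
  moreover have "lifted F (\<lambda>p. g' v p + h' v p)" for v
    by (intro lifted.lifted_add l)
  ultimately show ?case
    by (intro exI[of _ "\<lambda>v p. g' v p + h' v p"]) simp
next
  case (lifted_mult g h)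
  then obtain g' h' where d: "\<forall>p\<in>strip U. (g has_derivative (\<lambda>v. g' v p)) (at p)"
    "\<forall>p\<in>strip U. (h has_derivative (\<lambda>v. h' v p)) (at p)"
    and l: "\<And>v. lifted F (g' v)" "\<And>v. lifted F (h' v)" by metis
  have "\<forall>p\<in>strip U. ((\<lambda>p. g p * h p) has_derivative (\<lambda>v. g p * h' v p + g' v p * h p)) (at p)"
    using d by (auto intro: has_derivative_mult)
  moreover have "lifted F (\<lambda>p. g p * h' v p + g' v p * h p)" for v
    by (intro lifted.lifted_add lifted.lifted_mult l lifted_mult.hyps)
  ultimately show ?case
    by (intro exI[of _ "\<lambda>v p. g p * h' v p + g' v p * h p"]) simp
qed

lemma smooth_on_cyl:
  assumes U: "open U" "smooth_on U F"
  shows "smooth_on (strip U) (cyl F)"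
proof (rule smooth_on_coinduct[where P = "lifted F", OF open_strip[OF U(1)]])
  have "lifted F (\<lambda>p. of_real (1 / cos (fst p)) * ddirs [] F (conf p))"
    by (intro lifted.intros)
  then show "lifted F (cyl F)"
    by (simp add: cyl_def[abs_def] scaleR_conv_of_real)
  fix G assume "lifted F G"
  from lifted_differentiable[OF U this] obtain g' where
    d: "\<And>p. p\<in>strip U \<Longrightarrow> (G has_derivative (\<lambda>v. g' v p)) (at p)" and l: "\<And>v. lifted F (g' v)"
    by blast
  show "G differentiable_on strip U"
    using d by (meson differentiable_at_withinI differentiable_def differentiable_on_def)
  show "\<exists>H. lifted F H \<and> (\<forall>x\<in>strip U. ddir v G x = H x)" for v
    using l ddir_unique[OF d] by blast
qed

section \<open>The field equation on the cylinder\<close>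

lemma box_amb_eq:
  "box_amb F x = - ddir (1, 0) (ddir (1, 0) F) x + (\<Sum>b\<in>Basis. ddir (0, b) (ddir (0, b) F) x)"
proof -
  have "inj_on (\<lambda>u::real. (u, 0::real^4)) Basis" "inj_on (\<lambda>v::real^4. (0::real, v)) Basis"
    by (auto intro: inj_onI)
  then show ?thesis
    unfolding box_amb_def Basis_prod_def
    by (subst sum.union_disjoint) (auto simp: sum.reindex mink_def)
qed

text \<open>Along a time line at fixed \<open>y\<close> everything happens in the plane of
  \<open>(1, 0)\<close> and \<open>(0, y)\<close>. Both equations thus reduce to derivatives of
  \<open>F\<close> in these two directions and the spatial trace \<open>L\<close>.\<close>

lemma box_dS_cyl:
  assumes U: "open U" "dS4 \<subseteq> U" "smooth_on U F" and t: "\<bar>t\<bar> < pi/2" and y: "norm y = 1"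
    and eq: "box_dS F (conf (t, y)) - 2 * F (conf (t, y)) = 0"
  shows "ddir (1, 0) (ddir (1, 0) (cyl F)) (t, y) =
      (\<Sum>b\<in>Basis. ddir (0, b) (ddir (0, b) (cyl F)) (t, y)) - ddir (0, y) (ddir (0, y) (cyl F)) (t, y)
      - 3 *\<^sub>R ddir (0, y) (cyl F) (t, y) - cyl F (t, y)"
proof -
  let ?S = "{- pi/2 <..< pi/2}"
  define x where "x s = conf (s, y)" for s
  \<comment> \<open>The unit timelike tangent of the curve \<open>x\<close>. Each of
    \<open>x\<close> and \<open>T\<close> has \<open>sc s\<close> times the other as its velocity,
    as in a hyperbolic rotation.\<close>
  define T where "T s = (1 / cos s, tan s *\<^sub>R y)" for s
  define sc where "sc s = 1 / cos s" for s :: real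
  have S: "\<bar>s\<bar> < pi/2" if "s \<in> ?S" for s
    using that unfolding greaterThanLessThan_iff by linarith
  have tS: "t \<in> ?S" using t unfolding greaterThanLessThan_iff by linarith
  have cs: "cos s \<noteq> 0" if "s \<in> ?S" for s
    using cos_pos_strip[OF S[OF that]] by simp
  have xU: "x s \<in> U" if "s \<in> ?S" for s
    using conf_mem_dS4[OF S[OF that] y] U(2) by (auto simp: x_def)
  have strip: "(s, y) \<in> strip U" if "s \<in> ?S" for s
    using xU[OF that] S[OF that] by (simp add: strip_def x_def)
  note V = open_strip[OF U(1)] smooth_on_cyl[OF U(1,3)]
  have dsc: "(sc has_real_derivative sc s * tan s) (at s within A)" if "s \<in> ?S" for s A
    unfolding sc_def[abs_def] by (rule DERIV_sec[OF cs[OF that]])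
  have dtan: "(tan has_real_derivative (sc s)\<^sup>2) (at s within A)" if "s \<in> ?S" for s A
    unfolding sc_def by (rule DERIV_tan_sec[OF cs[OF that]])
  have dx: "(x has_vector_derivative sc s *\<^sub>R T s) (at s within A)" if "s \<in> ?S" for s A
    using has_vector_derivative_Pair[OF dtan[OF that, unfolded has_real_derivative_iff_has_vector_derivative]
        has_vector_derivative_scaleR[OF dsc[OF that] has_vector_derivative_const[of y]]]
    by (simp add: x_def[abs_def] T_def conf_def sc_def power2_eq_square)
  have dT: "(T has_vector_derivative sc s *\<^sub>R x s) (at s within A)" if "s \<in> ?S" for s A
    using has_vector_derivative_Pair[OF dsc[OF that, unfolded has_real_derivative_iff_has_vector_derivative]
        has_vector_derivative_scaleR[OF dtan[OF that] has_vector_derivative_const[of y]]]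
    by (simp add: T_def[abs_def] x_def conf_def sc_def power2_eq_square)
  have curve: "((\<lambda>s. (s, y)) has_vector_derivative (1, 0)) (at s)" for s
    by (intro has_vector_derivative_Pair has_vector_derivative_id has_vector_derivative_const)
  have first: "ddir (1, 0) (cyl F) (s, y) = sc s *\<^sub>R ddir (sc s *\<^sub>R T s) F (x s) + (sc s * tan s) *\<^sub>R F (x s)"
    if s: "s \<in> ?S" for s
  proof -
    have "((\<lambda>s. sc s *\<^sub>R F (x s)) has_vector_derivative
      sc s *\<^sub>R ddir (sc s *\<^sub>R T s) F (x s) + (sc s * tan s) *\<^sub>R F (x s)) (at s)"
      by (intro has_vector_derivative_scaleR dsc[OF s] ddir_curve[where c = x, OF U(1,3) xU[OF s] dx[OF s]])
    moreover have "((\<lambda>s. cyl F (s, y)) has_vector_derivative ddir (1, 0) (cyl F) (s, y)) (at s)"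
      by (rule ddir_curve[OF V strip[OF s] curve])
    ultimately show ?thesis
      by (intro vector_derivative_unique_at) (auto simp: cyl_def x_def sc_def)
  qed
  have lin: "linear (\<lambda>v. ddir v F (x s))" if "s \<in> ?S" for s
    by (rule linear_ddir[OF U(1,3) xU[OF that]])
  have first': "ddir (1, 0) (cyl F) (s, y) = (sc s)\<^sup>2 *\<^sub>R ddir (T s) F (x s) + (sc s * tan s) *\<^sub>R F (x s)"
    if s: "s \<in> ?S" for s
    using first[OF s] linear_scale[OF lin[OF s]] by (simp add: power2_eq_square)
  have second: "ddir (1, 0) (ddir (1, 0) (cyl F)) (t, y) =
      ((sc t)\<^sup>2 *\<^sub>R (ddir (sc t *\<^sub>R x t) F (x t) + ddir (sc t *\<^sub>R T t) (ddir (T t) F) (x t))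
        + (2 * sc t * (sc t * tan t)) *\<^sub>R ddir (T t) F (x t))
      + ((sc t * tan t) *\<^sub>R ddir (sc t *\<^sub>R T t) F (x t)
        + (sc t * tan t * tan t + sc t * (sc t)\<^sup>2) *\<^sub>R F (x t))"
  proof -
    have "((\<lambda>s. (sc s)\<^sup>2 *\<^sub>R ddir (T s) F (x s) + (sc s * tan s) *\<^sub>R F (x s)) has_vector_derivative
      ((sc t)\<^sup>2 *\<^sub>R (ddir (sc t *\<^sub>R x t) F (x t) + ddir (sc t *\<^sub>R T t) (ddir (T t) F) (x t))
        + (2 * sc t * (sc t * tan t)) *\<^sub>R ddir (T t) F (x t))
      + ((sc t * tan t) *\<^sub>R ddir (sc t *\<^sub>R T t) F (x t)
        + (sc t * tan t * tan t + sc t * (sc t)\<^sup>2) *\<^sub>R F (x t))) (at t within ?S)"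
    proof (intro has_vector_derivative_add has_vector_derivative_scaleR
          ddir_vector_field_curve[OF U(1,3) xU tS] ddir_curve[where c = x, OF U(1,3) xU[OF tS]] dx[OF tS] dT[OF tS])
      show "((\<lambda>s. (sc s)\<^sup>2) has_real_derivative 2 * sc t * (sc t * tan t)) (at t within ?S)"
        using DERIV_power[OF dsc[OF tS], of 2] by (simp add: mult_ac)
      show "((\<lambda>s. sc s * tan s) has_real_derivative sc t * tan t * tan t + sc t * (sc t)\<^sup>2) (at t within ?S)"
        using DERIV_mult[OF dsc[OF tS] dtan[OF tS]] by (simp add: algebra_simps)
    qed auto
    then have "((\<lambda>s. ddir (1, 0) (cyl F) (s, y)) has_vector_derivative
      ((sc t)\<^sup>2 *\<^sub>R (ddir (sc t *\<^sub>R x t) F (x t) + ddir (sc t *\<^sub>R T t) (ddir (T t) F) (x t))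
        + (2 * sc t * (sc t * tan t)) *\<^sub>R ddir (T t) F (x t))
      + ((sc t * tan t) *\<^sub>R ddir (sc t *\<^sub>R T t) F (x t)
        + (sc t * tan t * tan t + sc t * (sc t)\<^sup>2) *\<^sub>R F (x t))) (at t within ?S)"
      by (rule has_vector_derivative_transform[OF tS, rotated]) (rule first')
    moreover have "((\<lambda>s. ddir (1, 0) (cyl F) (s, y)) has_vector_derivative
      ddir (1, 0) (ddir (1, 0) (cyl F)) (t, y)) (at t)"
      by (rule ddir_curve[OF V(1) smooth_on_ddir[OF V(2)] strip[OF tS] curve])
    ultimately show ?thesis
      using vector_derivative_unique_at at_within_open[OF tS] by simp
  qed
  have sp1: "ddir (0, v) (cyl F) p = (sc (fst p))\<^sup>2 *\<^sub>R ddir (0, v) F (conf p)" if p: "p \<in> strip U" for v p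
  proof -
    have pS: "fst p \<in> ?S" using p unfolding strip_def by (auto simp: abs_less_iff)
    have "ddir (0, v) (cyl F) p = sc (fst p) *\<^sub>R ddir (conf' p (0, v)) F (conf p)"
      using ddir_unique[OF ddir_conf[OF U(1,3) p dsc[OF pS]]] by (simp add: cyl_def[abs_def] sc_def)
    also have "conf' p (0, v) = sc (fst p) *\<^sub>R (0, v)"
      by (simp add: conf'_def sc_def)
    also have "ddir (sc (fst p) *\<^sub>R (0, v)) F (conf p) = sc (fst p) *\<^sub>R ddir (0, v) F (conf p)"
      using p by (intro linear_scale[OF linear_ddir[OF U(1,3)]]) (simp add: strip_def)
    finally show ?thesis by (simp add: power2_eq_square)
  qed
  have sp2: "ddir (0, v) (ddir (0, v) (cyl F)) (t, y) = (sc t)^3 *\<^sub>R ddir (0, v) (ddir (0, v) F) (x t)" for v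
  proof -
    have d: "((\<lambda>s. (sc s)\<^sup>2) has_real_derivative 2 * sc t * (sc t * tan t)) (at (fst (t, y)))"
      using DERIV_power[OF dsc[OF tS], of 2] by (simp add: mult_ac)
    note D = ddir_conf[OF U(1) smooth_on_ddir[OF U(3)] strip[OF tS] d, of "(0, v)"]
    have "ddir (0, v) (ddir (0, v) (cyl F)) (t, y)
      = ddir (0, v) (\<lambda>p. (sc (fst p))\<^sup>2 *\<^sub>R ddir (0, v) F (conf p)) (t, y)"
      by (rule ddir_cong_open[OF V(1) strip[OF tS] sp1 D])
    also have "\<dots> = (sc t)\<^sup>2 *\<^sub>R ddir (conf' (t, y) (0, v)) (ddir (0, v) F) (x t)"
      unfolding ddir_unique[OF D] by (simp add: x_def)
    also have "conf' (t, y) (0, v) = sc t *\<^sub>R (0, v)"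
      by (simp add: conf'_def sc_def)
    also have "ddir (sc t *\<^sub>R (0, v)) (ddir (0, v) F) (x t) = sc t *\<^sub>R ddir (0, v) (ddir (0, v) F) (x t)"
      by (rule linear_scale[OF linear_ddir[OF U(1) smooth_on_ddir[OF U(3)] xU[OF tS]]])
    finally show ?thesis by (simp add: power2_eq_square power3_eq_cube)
  qed
  define D where "D v = ddir v F (x t)" for v
  define B where "B v w = ddir v (ddir w F) (x t)" for v w
  interpret D: linear D
    unfolding D_def by (rule lin[OF tS])
  interpret B1: linear "\<lambda>v. B v w" for w
    unfolding B_def by (rule linear_ddir[OF U(1) smooth_on_ddir[OF U(3)] xU[OF tS]])
  interpret B2: linear "B v" for v
    unfolding B_def by (rule linear_ddir_ddir[OF U(1,3) xU[OF tS]])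
  have B_sym: "B v w = B w v" for v w
    unfolding B_def by (rule ddir_commute[OF U(1,3) xU[OF tS]])
  let ?e = "(1, 0) :: pt" and ?y = "(0, y) :: pt"
  have T_eq: "T t = sc t *\<^sub>R ?e + tan t *\<^sub>R ?y" and x_eq: "x t = tan t *\<^sub>R ?e + sc t *\<^sub>R ?y"
    by (simp_all add: T_def x_def conf_def sc_def)
  have DT: "D (T t) = sc t *\<^sub>R D ?e + tan t *\<^sub>R D ?y" "D (x t) = tan t *\<^sub>R D ?e + sc t *\<^sub>R D ?y"
    unfolding T_eq x_eq by (simp_all only: D.add D.scale)
  have BT: "B (T t) (T t) = (sc t * sc t) *\<^sub>R B ?e ?e + (2 * sc t * tan t) *\<^sub>R B ?e ?y + (tan t * tan t) *\<^sub>R B ?y ?y"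
    "B (x t) (x t) = (tan t * tan t) *\<^sub>R B ?e ?e + (2 * sc t * tan t) *\<^sub>R B ?e ?y + (sc t * sc t) *\<^sub>R B ?y ?y"
    unfolding T_eq x_eq
    by (simp_all only: B1.add B2.add B1.scale B2.scale B_sym[of ?y ?e])
      (simp_all add: scaleR_conv_of_real algebra_simps)
  define L where "L = (\<Sum>b\<in>Basis. B (0, b) (0, b))"
  have box: "- B ?e ?e + L - B (x t) (x t) - 4 * D (x t) - 2 * F (x t) = 0"
    using eq by (simp add: box_dS_def box_amb_eq L_def B_def D_def x_def)
  have tt: "ddir (1, 0) (ddir (1, 0) (cyl F)) (t, y) =
      (sc t)^3 *\<^sub>R (D (x t) + B (T t) (T t)) + (3 * (sc t)\<^sup>2 * tan t) *\<^sub>R D (T t)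
      + (sc t * ((tan t)\<^sup>2 + (sc t)\<^sup>2)) *\<^sub>R F (x t)"
    unfolding second D_def[symmetric] B_def[symmetric] D.scale B1.scale
    by (simp add: scaleR_conv_of_real power2_eq_square power3_eq_cube algebra_simps)
  have sum: "(\<Sum>b\<in>Basis. ddir (0, b) (ddir (0, b) (cyl F)) (t, y)) = (sc t)^3 *\<^sub>R L"
    by (simp add: sp2 L_def B_def scaleR_sum_right)
  have yy: "ddir ?y (ddir ?y (cyl F)) (t, y) = (sc t)^3 *\<^sub>R B ?y ?y"
    "ddir ?y (cyl F) (t, y) = (sc t)\<^sup>2 *\<^sub>R D ?y" "cyl F (t, y) = sc t *\<^sub>R F (x t)"
    using sp1[OF strip[OF tS]] by (simp_all add: sp2 B_def D_def cyl_def sc_def x_def)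
  have st: "complex_of_real (sc t) * complex_of_real (sc t) = 1 + complex_of_real (tan t) * complex_of_real (tan t)"
    using sec_squared[OF cs[OF tS]] unfolding sc_def power2_eq_square
    by (metis of_real_1 of_real_add of_real_mult)
  \<comment> \<open>The claim is \<open>box\<close> times the cube of \<open>sc t\<close>, with
    \<open>sec^2 - tan^2 = 1\<close> used at each order:
    \<open>B T T - B x x = B e e - B y y\<close>, then \<open>tan * T - sec * x = - y\<close>, and
    \<open>sec * (tan^2 + sec^2) = 2 * sec^3 - sec\<close>, where the mass 2 absorbs the cubic
    term.\<close>
  from box st show ?thesis
    unfolding tt sum yy DT BT scaleR_conv_of_real of_real_mult of_real_add of_real_power of_real_numeral
    by algebra
qed

section \<open>Boundary data\<close>

lemma dS4_conf:
  assumes "x \<in> dS4"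
  obtains t y where "\<bar>t\<bar> < pi/2" "norm y = 1" "x = conf (t, y)"
proof
  define t where "t = arctan (fst x)"
  show t: "\<bar>arctan (fst x)\<bar> < pi/2"
    using arctan_bounded[of "fst x"] by linarith
  have c: "cos t \<noteq> 0"
    using cos_pos_strip t by (auto simp: t_def)
  have "snd x \<bullet> snd x = 1 + (fst x)\<^sup>2"
    using assms by (simp add: dS4_def mink_def power2_eq_square)
  also have "\<dots> = (1 / cos t)\<^sup>2"
    using sec_squared[OF c] by (simp add: t_def tan_arctan)
  finally have "(cos t *\<^sub>R snd x) \<bullet> (cos t *\<^sub>R snd x) = 1"
    using c by (simp add: power2_eq_square field_simps)
  then show "norm (cos t *\<^sub>R snd x) = 1"
    by (simp only: norm_eq_1)
  show "x = conf (arctan (fst x), cos t *\<^sub>R snd x)"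
    using c by (simp add: conf_def t_def tan_arctan prod_eq_iff)
qed

lemma conf_minus: "conf (- t, - y) = - conf (t, y)"
  by (simp add: conf_def)

lemma conf_arctan: "conf (arctan s, \<omega>) = gcoord s \<omega>"
  by (simp add: conf_def gcoord_def tan_arctan cos_arctan)

lemma filterlim_arctan_inverse:
  "filterlim (\<lambda>z::real. arctan (1 / z)) (at_left (pi/2)) (at_right 0)"
  "filterlim (\<lambda>z::real. arctan (1 / z)) (at_right (-pi/2)) (at_left 0)"
proof -
  have "((\<lambda>z::real. arctan (inverse z)) \<longlongrightarrow> pi/2) (at_right 0)"
    by (rule filterlim_compose[OF tendsto_arctan_at_top filterlim_inverse_at_top_right])
  then show "filterlim (\<lambda>z::real. arctan (1 / z)) (at_left (pi/2)) (at_right 0)"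
    using arctan_ubound by (simp add: filterlim_at inverse_eq_divide less_imp_neq always_eventually)
  have "((\<lambda>z::real. arctan (inverse z)) \<longlongrightarrow> -(pi/2)) (at_left 0)"
    by (rule filterlim_compose[OF tendsto_arctan_at_bot filterlim_inverse_at_bot_neg])
  then show "filterlim (\<lambda>z::real. arctan (1 / z)) (at_right (-pi/2)) (at_left 0)"
    using arctan_lbound
    by (simp add: filterlim_at inverse_eq_divide less_imp_neq[THEN not_sym] always_eventually)
qed

text \<open>Only values of \<phi> on de Sitter space are tied to \<Psi>, so fields built from
  unrelated ambient extensions can be compared on the cylinder.\<close>

locale conformal_field = cylinder_wave +
  fixes \<phi> :: "pt \<Rightarrow> complex"
  assumes rescaled: "\<And>t y. \<bar>t\<bar> < pi/2 \<Longrightarrow> norm y = 1 \<Longrightarrow> \<phi> (conf (t, y)) = cos t *\<^sub>R \<Psi> (t, y)"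
begin

text \<open>Dirichlet statements about the time derivative are the Neumann statements about
  \<phi>.\<close>

sublocale dt: cylinder_wave "ddir (1, 0) \<Psi>" V
  by (rule time_derivative)

lemma has_time_derivative:
  assumes "\<bar>t\<bar> < pi/2" "norm y = 1"
  shows "((\<lambda>s. \<Psi> (s, y)) has_vector_derivative ddir (1, 0) \<Psi> (t, y)) (at t)"
  by (rule ddir_curve[where c = "\<lambda>s. (s, y)", OF V dom[OF assms]])
    (intro has_vector_derivative_Pair has_vector_derivative_id has_vector_derivative_const)

lemma arctan_inverse_less: "\<bar>arctan (1 / z)\<bar> < pi/2"
  using arctan_bounded[of "1 / z"] by linarith

text \<open>Since \<open>z\<close> is the cotangent of \<open>t\<close>, division by
  \<open>z\<close> turns the factor \<open>cos t\<close> into \<open>sin t\<close>, which tends to 1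
  or -1 at the boundary.\<close>

lemma resc_eq:
  assumes "norm \<omega> = 1" "z \<noteq> 0"
  shows "resc \<phi> \<omega> z = sin (arctan (1 / z)) *\<^sub>R \<Psi> (arctan (1 / z), \<omega>)"
proof -
  have "cos (arctan (1 / z)) / z = sin (arctan (1 / z))"
    using tan_arctan[of "1 / z"] assms(2) by (simp add: tan_def field_simps)
  then have "complex_of_real (sin (arctan (1 / z))) = complex_of_real (cos (arctan (1 / z))) / complex_of_real z"
    by (metis of_real_divide)
  then show ?thesis
    using rescaled[OF arctan_inverse_less assms(1), of z]
    by (simp add: resc_def conf_arctan scaleR_conv_of_real)
qed

lemma dz_resc_eq:
  assumes \<omega>: "norm \<omega> = 1" and z: "z \<noteq> 0"
  defines "t \<equiv> arctan (1 / z)"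
  shows "dz_resc \<phi> \<omega> z = (- (1 / (1 + z\<^sup>2))) *\<^sub>R (sin t *\<^sub>R ddir (1, 0) \<Psi> (t, \<omega>) + cos t *\<^sub>R \<Psi> (t, \<omega>))"
proof -
  have z': "1 + (1 / z)\<^sup>2 \<noteq> 0" "1 + z\<^sup>2 \<noteq> 0"
    by (metis add_cancel_right_left add_eq_0_iff not_one_le_zero sum_power2_eq_zero_iff power_one zero_neq_one)+
  have "((\<lambda>z. arctan (1 / z)) has_real_derivative - (1 / (1 + z\<^sup>2))) (at z)"
    by (rule derivative_eq_intros refl z)+ (use z in \<open>simp add: field_simps power2_eq_square\<close>)
  then have 1: "((\<lambda>z. arctan (1 / z)) has_vector_derivative - (1 / (1 + z\<^sup>2))) (at z)"
    by (simp add: has_real_derivative_iff_has_vector_derivative)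
  have 2: "((\<lambda>t. sin t *\<^sub>R \<Psi> (t, \<omega>)) has_vector_derivative
      sin t *\<^sub>R ddir (1, 0) \<Psi> (t, \<omega>) + cos t *\<^sub>R \<Psi> (t, \<omega>)) (at (arctan (1 / z)))"
    unfolding t_def
    by (intro has_vector_derivative_scaleR DERIV_sin has_time_derivative arctan_inverse_less \<omega>)
  have "((\<lambda>z. sin (arctan (1 / z)) *\<^sub>R \<Psi> (arctan (1 / z), \<omega>)) has_vector_derivative
    (- (1 / (1 + z\<^sup>2))) *\<^sub>R (sin t *\<^sub>R ddir (1, 0) \<Psi> (t, \<omega>) + cos t *\<^sub>R \<Psi> (t, \<omega>))) (at z)"
    using vector_diff_chain_at[OF 1 2] by (simp add: o_def)
  then have "(resc \<phi> \<omega> has_vector_derivative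
    (- (1 / (1 + z\<^sup>2))) *\<^sub>R (sin t *\<^sub>R ddir (1, 0) \<Psi> (t, \<omega>) + cos t *\<^sub>R \<Psi> (t, \<omega>))) (at z)"
    by (rule has_vector_derivative_transform_within_open[of _ _ _ "- {0}"])
      (use z resc_eq[OF \<omega>] in auto)
  then show ?thesis
    unfolding dz_resc_def by (rule vector_derivative_at)
qed

lemma resc_tendsto:
  assumes \<omega>: "norm \<omega> = 1"
  shows "((\<lambda>t. \<Psi> (t, \<omega>)) \<longlongrightarrow> L) (at_left (pi/2)) \<Longrightarrow> (resc \<phi> \<omega> \<longlongrightarrow> L) (at_right 0)"
    and "((\<lambda>t. \<Psi> (t, \<omega>)) \<longlongrightarrow> L) (at_right (-pi/2)) \<Longrightarrow> (resc \<phi> \<omega> \<longlongrightarrow> - L) (at_left 0)"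
proof -
  have sin: "((\<lambda>z. sin (arctan (1 / z))) \<longlongrightarrow> sin (pi/2)) (at_right (0::real))"
    "((\<lambda>z. sin (arctan (1 / z))) \<longlongrightarrow> sin (-pi/2)) (at_left (0::real))"
    using filterlim_arctan_inverse by (intro tendsto_sin; simp add: filterlim_at)+
  have ev: "\<forall>\<^sub>F z in at 0 within S. sin (arctan (1 / z)) *\<^sub>R \<Psi> (arctan (1 / z), \<omega>) = resc \<phi> \<omega> z" for S
    using resc_eq[OF \<omega>] by (simp add: eventually_at_filter)
  show "(resc \<phi> \<omega> \<longlongrightarrow> L) (at_right 0)" if "((\<lambda>t. \<Psi> (t, \<omega>)) \<longlongrightarrow> L) (at_left (pi/2))"
    using Lim_transform_eventually[OF tendsto_scaleR[OF sin(1)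
          filterlim_compose[OF that filterlim_arctan_inverse(1)]] ev] by simp
  show "(resc \<phi> \<omega> \<longlongrightarrow> - L) (at_left 0)" if "((\<lambda>t. \<Psi> (t, \<omega>)) \<longlongrightarrow> L) (at_right (-pi/2))"
    using Lim_transform_eventually[OF tendsto_scaleR[OF sin(2)
          filterlim_compose[OF that filterlim_arctan_inverse(2)]] ev] by simp
qed

text \<open>The term \<open>cos t * \<Psi>\<close> drops out because \<Psi> itself converges. The
  other signs are that of \<open>sin t\<close> and the -1 from the derivative of
  \<open>arctan (1 / z)\<close>.\<close>

lemma dz_resc_tendsto:
  assumes \<omega>: "norm \<omega> = 1"
  shows "((\<lambda>t. ddir (1, 0) \<Psi> (t, \<omega>)) \<longlongrightarrow> L) (at_left (pi/2)) \<Longrightarrow> (dz_resc \<phi> \<omega> \<longlongrightarrow> - L) (at_right 0)"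
    and "((\<lambda>t. ddir (1, 0) \<Psi> (t, \<omega>)) \<longlongrightarrow> L) (at_right (-pi/2)) \<Longrightarrow> (dz_resc \<phi> \<omega> \<longlongrightarrow> L) (at_left 0)"
proof -
  have sin: "((\<lambda>z. sin (arctan (1 / z))) \<longlongrightarrow> sin (pi/2)) (at_right (0::real))"
    "((\<lambda>z. sin (arctan (1 / z))) \<longlongrightarrow> sin (-pi/2)) (at_left (0::real))"
    using filterlim_arctan_inverse by (intro tendsto_sin; simp add: filterlim_at)+
  have cos: "((\<lambda>z. cos (arctan (1 / z))) \<longlongrightarrow> cos (pi/2)) (at_right (0::real))"
    "((\<lambda>z. cos (arctan (1 / z))) \<longlongrightarrow> cos (-pi/2)) (at_left (0::real))"
    using filterlim_arctan_inverse by (intro tendsto_cos; simp add: filterlim_at)+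
  have c: "((\<lambda>z::real. - (1 / (1 + z\<^sup>2))) \<longlongrightarrow> - (1 / (1 + 0\<^sup>2))) (at 0 within S)" for S
    by (intro tendsto_intros) auto
  have ev: "\<forall>\<^sub>F z in at 0 within S. (- (1 / (1 + z\<^sup>2))) *\<^sub>R (sin (arctan (1 / z)) *\<^sub>R ddir (1, 0) \<Psi> (arctan (1 / z), \<omega>)
      + cos (arctan (1 / z)) *\<^sub>R \<Psi> (arctan (1 / z), \<omega>)) = dz_resc \<phi> \<omega> z" for S
    using dz_resc_eq[OF \<omega>] by (simp add: eventually_at_filter)
  obtain M N where M: "((\<lambda>t. \<Psi> (t, \<omega>)) \<longlongrightarrow> M) (at_left (pi/2))"
    and N: "((\<lambda>t. \<Psi> (t, \<omega>)) \<longlongrightarrow> N) (at_right (-pi/2))"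
    using boundary_limits[OF \<omega>] by blast
  show "(dz_resc \<phi> \<omega> \<longlongrightarrow> - L) (at_right 0)" if "((\<lambda>t. ddir (1, 0) \<Psi> (t, \<omega>)) \<longlongrightarrow> L) (at_left (pi/2))"
    using Lim_transform_eventually[OF tendsto_scaleR[OF c tendsto_add[OF
          tendsto_scaleR[OF sin(1) filterlim_compose[OF that filterlim_arctan_inverse(1)]]
          tendsto_scaleR[OF cos(1) filterlim_compose[OF M filterlim_arctan_inverse(1)]]]] ev] by simp
  show "(dz_resc \<phi> \<omega> \<longlongrightarrow> L) (at_left 0)" if "((\<lambda>t. ddir (1, 0) \<Psi> (t, \<omega>)) \<longlongrightarrow> L) (at_right (-pi/2))"
    using Lim_transform_eventually[OF tendsto_scaleR[OF c tendsto_add[OF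
          tendsto_scaleR[OF sin(2) filterlim_compose[OF that filterlim_arctan_inverse(2)]]
          tendsto_scaleR[OF cos(2) filterlim_compose[OF N filterlim_arctan_inverse(2)]]]] ev] by simp
qed

lemma boundary_limits_exist:
  assumes "norm \<omega> = 1"
  shows "\<exists>L. (resc \<phi> \<omega> \<longlongrightarrow> L) (at_right 0)" "\<exists>L. (resc \<phi> \<omega> \<longlongrightarrow> L) (at_left 0)"
    "\<exists>L. (dz_resc \<phi> \<omega> \<longlongrightarrow> L) (at_right 0)" "\<exists>L. (dz_resc \<phi> \<omega> \<longlongrightarrow> L) (at_left 0)"
proof -
  obtain L L' where l: "((\<lambda>t. \<Psi> (t, \<omega>)) \<longlongrightarrow> L) (at_left (pi/2))" "((\<lambda>t. \<Psi> (t, \<omega>)) \<longlongrightarrow> L') (at_right (-pi/2))"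
    using boundary_limits[OF assms] by blast
  show "\<exists>L. (resc \<phi> \<omega> \<longlongrightarrow> L) (at_right 0)" "\<exists>L. (resc \<phi> \<omega> \<longlongrightarrow> L) (at_left 0)"
    by (rule exI, rule resc_tendsto[OF assms], rule l)+
  obtain L L' where dl: "((\<lambda>t. ddir (1, 0) \<Psi> (t, \<omega>)) \<longlongrightarrow> L) (at_left (pi/2))"
    "((\<lambda>t. ddir (1, 0) \<Psi> (t, \<omega>)) \<longlongrightarrow> L') (at_right (-pi/2))"
    using dt.boundary_limits[OF assms] by blast
  show "\<exists>L. (dz_resc \<phi> \<omega> \<longlongrightarrow> L) (at_right 0)" "\<exists>L. (dz_resc \<phi> \<omega> \<longlongrightarrow> L) (at_left 0)"
    by (rule exI, rule dz_resc_tendsto[OF assms], rule dl)+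
qed

text \<open>A value of \<open>Lim\<close> carries information only once convergence is known, hence
  the appeal to \<open>boundary_limits\<close>.\<close>

lemma dirichlet_zero_tendsto:
  assumes \<omega>: "norm \<omega> = 1" and zero: "bd_phi_minus \<phi> \<omega> = 0"
  shows "((\<lambda>t. \<Psi> (t, \<omega>)) \<longlongrightarrow> 0) (at_right (-pi/2))"
proof -
  obtain L where L: "((\<lambda>t. \<Psi> (t, \<omega>)) \<longlongrightarrow> L) (at_right (-pi/2))"
    using boundary_limits[OF \<omega>] by blast
  have "Lim (at_left 0) (resc \<phi> \<omega>) = - L"
    by (rule tendsto_Lim[OF _ resc_tendsto(2)[OF \<omega> L]]) simp
  with zero L show ?thesis
    by (simp add: bd_phi_minus_def)
qed

lemma neumann_zero_tendsto:
  assumes \<omega>: "norm \<omega> = 1" and zero: "bd_pi_minus \<phi> \<omega> = 0"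
  shows "((\<lambda>t. ddir (1, 0) \<Psi> (t, \<omega>)) \<longlongrightarrow> 0) (at_right (-pi/2))"
proof -
  obtain L where L: "((\<lambda>t. ddir (1, 0) \<Psi> (t, \<omega>)) \<longlongrightarrow> L) (at_right (-pi/2))"
    using dt.boundary_limits[OF \<omega>] by blast
  have "Lim (at_left 0) (dz_resc \<phi> \<omega>) = L"
    by (rule tendsto_Lim[OF _ dz_resc_tendsto(2)[OF \<omega> L]]) simp
  with zero L show ?thesis
    by (simp add: bd_pi_minus_def)
qed

lemma parity:
  assumes par: "\<And>x. x \<in> dS4 \<Longrightarrow> \<phi> (- x) = \<epsilon> *\<^sub>R \<phi> x" and t: "\<bar>t\<bar> < pi/2" and y: "norm y = 1"
  shows "\<Psi> (- t, - y) = \<epsilon> *\<^sub>R \<Psi> (t, y)"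
proof -
  have "cos t *\<^sub>R \<Psi> (- t, - y) = cos t *\<^sub>R (\<epsilon> *\<^sub>R \<Psi> (t, y))"
    using par[OF conf_mem_dS4[OF t y]] rescaled[OF t y] rescaled[of "- t" "- y"] t y
    by (simp add: conf_minus mult.commute)
  then show ?thesis
    unfolding scaleR_cancel_left using cos_pos_strip[OF t] by simp
qed

end

lemma dS_solution_conformal_field:
  assumes "dS_solution \<phi>"
  obtains \<Psi> V where "conformal_field \<Psi> V \<phi>"
proof -
  obtain U F where U: "open U" "dS4 \<subseteq> U" "smooth_on U F" and F: "\<And>x. x \<in> dS4 \<Longrightarrow> F x = \<phi> x"
    and eq: "\<And>x. x \<in> dS4 \<Longrightarrow> box_dS F x - 2 * F x = 0"
    using assms unfolding dS_solution_def by blast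
  have "conformal_field (cyl F) (strip U) \<phi>"
  proof
    fix t y assume t: "\<bar>t::real\<bar> < pi/2" and y: "norm (y::real^4) = 1"
    note x = conf_mem_dS4[OF t y]
    show "(t, y) \<in> strip U"
      using x U(2) t by (auto simp: strip_def)
    show "ddir (1, 0) (ddir (1, 0) (cyl F)) (t, y) =
      (\<Sum>b\<in>Basis. ddir (0, b) (ddir (0, b) (cyl F)) (t, y)) - ddir (0, y) (ddir (0, y) (cyl F)) (t, y)
      - 3 *\<^sub>R ddir (0, y) (cyl F) (t, y) - cyl F (t, y)"
      by (rule box_dS_cyl[OF U t y eq[OF x]])
    show "\<phi> (conf (t, y)) = cos t *\<^sub>R cyl F (t, y)"
      using cos_pos_strip[OF t] F[OF x] by (simp add: cyl_def)
  qed (use open_strip smooth_on_cyl U in auto)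
  then show ?thesis by (rule that)
qed

section \<open>Boundary data of even and odd solutions\<close>

lemma even_boundary_data:
  assumes "dS_solution \<phi>" "antipodally_even \<phi>" "norm \<omega> = 1"
  shows "bd_phi_plus \<phi> \<omega> = 0" "bd_phi_minus \<phi> \<omega> = 0"
proof -
  obtain \<Psi> V where "conformal_field \<Psi> V \<phi>"
    using dS_solution_conformal_field[OF assms(1)] .
  then interpret conformal_field \<Psi> V \<phi> .
  have "\<Psi> (- t, - y) = \<Psi> (t, y)" if "\<bar>t\<bar> < pi/2" "norm y = 1" for t y
    using parity[of 1, OF _ that] assms(2) by (simp add: antipodally_even_def)
  note lim = even_imp_dirichlet_zero[OF this assms(3)]
  show "bd_phi_plus \<phi> \<omega> = 0"
    unfolding bd_phi_plus_def by (rule tendsto_Lim[OF _ resc_tendsto(1)[OF assms(3) lim(1)]]) simp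
  show "bd_phi_minus \<phi> \<omega> = 0"
    unfolding bd_phi_minus_def using tendsto_Lim[OF _ resc_tendsto(2)[OF assms(3) lim(2)]] by simp
qed

lemma (in conformal_field) odd_time_derivative_tendsto:
  assumes "antipodally_odd \<phi>" "norm \<omega> = 1"
  shows "((\<lambda>t. ddir (1, 0) \<Psi> (t, \<omega>)) \<longlongrightarrow> 0) (at_left (pi/2))"
    and "((\<lambda>t. ddir (1, 0) \<Psi> (t, \<omega>)) \<longlongrightarrow> 0) (at_right (-pi/2))"
proof -
  have "\<Psi> (- t, - y) = - 1 *\<^sub>R \<Psi> (t, y)" if "\<bar>t\<bar> < pi/2" "norm y = 1" for t y
    using parity[of "- 1", OF _ that] assms(1) by (simp add: antipodally_odd_def)
  then have "ddir (1, 0) \<Psi> (- t, - y) = - (- 1) *\<^sub>R ddir (1, 0) \<Psi> (t, y)" if "\<bar>t\<bar> < pi/2" "norm y = 1" for t y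
    using time_derivative_parity[OF _ that, of "- 1"] by blast
  then have "ddir (1, 0) \<Psi> (- t, - y) = ddir (1, 0) \<Psi> (t, y)" if "\<bar>t\<bar> < pi/2" "norm y = 1" for t y
    using that by simp
  from dt.even_imp_dirichlet_zero[OF this assms(2)]
  show "((\<lambda>t. ddir (1, 0) \<Psi> (t, \<omega>)) \<longlongrightarrow> 0) (at_left (pi/2))"
    "((\<lambda>t. ddir (1, 0) \<Psi> (t, \<omega>)) \<longlongrightarrow> 0) (at_right (-pi/2))" by blast+
qed

lemma odd_boundary_data:
  assumes "dS_solution \<phi>" "antipodally_odd \<phi>" "norm \<omega> = 1"
  shows "bd_pi_plus \<phi> \<omega> = 0" "bd_pi_minus \<phi> \<omega> = 0"
proof -
  obtain \<Psi> V where "conformal_field \<Psi> V \<phi>"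
    using dS_solution_conformal_field[OF assms(1)] .
  then interpret conformal_field \<Psi> V \<phi> .
  note lim = odd_time_derivative_tendsto[OF assms(2,3)]
  show "bd_pi_plus \<phi> \<omega> = 0"
    unfolding bd_pi_plus_def using tendsto_Lim[OF _ dz_resc_tendsto(1)[OF assms(3) lim(1)]] by simp
  show "bd_pi_minus \<phi> \<omega> = 0"
    unfolding bd_pi_minus_def by (rule tendsto_Lim[OF _ dz_resc_tendsto(2)[OF assms(3) lim(2)]]) simp
qed

section \<open>Splitting a solution by parity, and the converse statements\<close>

lemma dS_solution_antipodal_combination:
  assumes "dS_solution \<phi>"
  shows "dS_solution (\<lambda>x. c * \<phi> x + d * \<phi> (- x))"
proof -
  obtain U F where U: "open U" "dS4 \<subseteq> U" "smooth_on U F" and F: "\<And>x. x \<in> dS4 \<Longrightarrow> F x = \<phi> x"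
    and eq: "\<And>x. x \<in> dS4 \<Longrightarrow> box_dS F x - 2 * F x = 0"
    using assms unfolding dS_solution_def by blast
  let ?W = "U \<inter> uminus ` U"
  \<comment> \<open>Each derivative only flips the sign of \<open>d\<close> and differentiates
    \<open>H\<close>, so with free coefficients these functions form a class closed under
    \<open>ddir\<close>.\<close>
  define comb where "comb H c d x = c * H x + d * H (- x)" for H :: "pt \<Rightarrow> complex" and c d x
  have minus: "- x \<in> U" "x \<in> U" if "x \<in> ?W" for x
    using that by auto
  have W: "open ?W"
    using U(1) open_negations by blast
  have neg: "- x \<in> dS4" if "x \<in> dS4" for x
    using that by (simp add: dS4_def mink_def)
  have dW: "dS4 \<subseteq> ?W"
  proof
    fix x assume x: "x \<in> dS4"
    then have "- x \<in> U" using neg U(2) by blast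
    then have "- (- x) \<in> uminus ` U" by (rule imageI)
    then show "x \<in> ?W" using x U(2) by auto
  qed
  have D: "(comb H c d has_derivative (\<lambda>v. comb (ddir v H) c (- d) x)) (at x)"
    if H: "smooth_on U H" and x: "x \<in> ?W" for H c d x
  proof -
    have "(H \<circ> uminus has_derivative (\<lambda>v. ddir v H (- x)) \<circ> uminus) (at x)"
      by (intro diff_chain_at has_derivative_ddir[OF U(1) H] minus(1)[OF x])
        (auto intro!: derivative_eq_intros)
    moreover have "ddir (- v) H (- x) = - ddir v H (- x)" for v
      by (rule linear_neg[OF linear_ddir[OF U(1) H minus(1)[OF x]]])
    ultimately have "((\<lambda>x. H (- x)) has_derivative (\<lambda>v. - ddir v H (- x))) (at x)"
      by (simp add: o_def)
    from has_derivative_add[OF has_derivative_mult_right[OF has_derivative_ddir[OF U(1) H minus(2)[OF x]]]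
        has_derivative_mult_right[OF this]]
    show ?thesis unfolding comb_def[abs_def] by simp
  qed
  note dd = ddir_unique[OF D]
  have dd2: "ddir w (ddir v (comb F c d)) x = comb (ddir w (ddir v F)) c d x" if x: "x \<in> ?W" for w v c d x
  proof -
    have "ddir w (ddir v (comb F c d)) x = ddir w (comb (ddir v F) c (- d)) x"
      by (rule ddir_cong_open[OF W x dd[OF U(3)] D[OF smooth_on_ddir[OF U(3)] x]])
    then show ?thesis
      using dd[OF smooth_on_ddir[OF U(3)] x] by simp
  qed
  have "smooth_on ?W (comb F c d)"
  proof (rule smooth_on_coinduct[where P = "\<lambda>G. \<exists>H c d. smooth_on U H \<and> G = comb H c d", OF W])
    show "\<exists>H c' d'. smooth_on U H \<and> comb F c d = comb H c' d'"
      using U(3) by blast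
    show "G differentiable_on ?W" if "\<exists>H c d. smooth_on U H \<and> G = comb H c d" for G
      using that D by (meson differentiable_at_withinI differentiable_def differentiable_on_def)
    show "\<exists>K. (\<exists>H c d. smooth_on U H \<and> K = comb H c d) \<and> (\<forall>x\<in>?W. ddir v G x = K x)"
      if "\<exists>H c d. smooth_on U H \<and> G = comb H c d" for G v
      using that dd smooth_on_ddir by metis
  qed
  moreover have "comb F c d x = c * \<phi> x + d * \<phi> (- x)" if "x \<in> dS4" for x
    using F that neg by (simp add: comb_def)
  moreover have "box_dS (comb F c d) x - 2 * comb F c d x = 0" if x: "x \<in> dS4" for x
  proof -
    have xW: "x \<in> ?W" using dW x by blast
    note mU = minus(1)[OF xW]
    have "box_amb (comb F c d) x = c * box_amb F x + d * box_amb F (- x)"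
      unfolding box_amb_def dd2[OF xW] by (simp add: comb_def sum_distrib_left sum.distrib algebra_simps)
    \<comment> \<open>The normal at the antipode is \<open>- x\<close>. Its sign squares away in the
      second-order term and cancels the flip of \<open>d\<close> in the first-order term.\<close>
    moreover have "ddir (- x) F (- x) = - ddir x F (- x)"
      by (rule linear_neg[OF linear_ddir[OF U(1,3) mU]])
    moreover have "ddir (- x) (ddir (- x) F) (- x) = ddir x (ddir x F) (- x)"
      using linear_neg[OF linear_ddir[OF U(1) smooth_on_ddir[OF U(3)] mU], of x "- x"]
        linear_neg[OF linear_ddir_ddir[OF U(1,3) mU], of x x] by simp
    ultimately have "box_dS (comb F c d) x - 2 * comb F c d x =
      c * (box_dS F x - 2 * F x) + d * (box_dS F (- x) - 2 * F (- x))"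
      unfolding box_dS_def dd2[OF xW] dd[OF U(3) xW] by (simp add: comb_def algebra_simps)
    then show ?thesis
      using eq[OF x] eq[OF neg[OF x]] by simp
  qed
  ultimately show ?thesis
    using W dW unfolding dS_solution_def by metis
qed

definition even_part :: "(pt \<Rightarrow> complex) \<Rightarrow> pt \<Rightarrow> complex" where
  "even_part \<phi> x = 1/2 * \<phi> x + 1/2 * \<phi> (- x)"

text \<open>Written as a sum with coefficient \<open>-1/2\<close> to be an instance of
  \<open>dS_solution_antipodal_combination\<close>.\<close>

definition odd_part :: "(pt \<Rightarrow> complex) \<Rightarrow> pt \<Rightarrow> complex" where
  "odd_part \<phi> x = 1/2 * \<phi> x + (- 1/2) * \<phi> (- x)"

lemma parts:
  "antipodally_even (even_part \<phi>)" "antipodally_odd (odd_part \<phi>)" "\<phi> x = even_part \<phi> x + odd_part \<phi> x"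
  by (auto simp: antipodally_even_def antipodally_odd_def even_part_def odd_part_def)

lemma dS_solution_parts:
  assumes "dS_solution \<phi>"
  shows "dS_solution (even_part \<phi>)" "dS_solution (odd_part \<phi>)"
  unfolding even_part_def[abs_def] odd_part_def[abs_def]
  by (rule dS_solution_antipodal_combination[OF assms])+

text \<open>The even part has zero Dirichlet data, so the odd part inherits those of \<phi>; being
  odd with zero data, it vanishes.\<close>

lemma dirichlet_zero_imp_even:
  assumes sol: "dS_solution \<phi>" and zero: "\<And>\<omega>. norm \<omega> = 1 \<Longrightarrow> bd_phi_minus \<phi> \<omega> = 0"
  shows "antipodally_even \<phi>"
proof -
  obtain \<Psi> V where "conformal_field \<Psi> V \<phi>"
    using dS_solution_conformal_field[OF sol] .
  then interpret a: conformal_field \<Psi> V \<phi> .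
  obtain \<Psi>e Ve where "conformal_field \<Psi>e Ve (even_part \<phi>)"
    using dS_solution_conformal_field[OF dS_solution_parts(1)[OF sol]] .
  then interpret e: conformal_field \<Psi>e Ve "even_part \<phi>" .
  obtain \<Psi>o Vo where "conformal_field \<Psi>o Vo (odd_part \<phi>)"
    using dS_solution_conformal_field[OF dS_solution_parts(2)[OF sol]] .
  then interpret o: conformal_field \<Psi>o Vo "odd_part \<phi>" .
  have split: "\<Psi> (t, y) - \<Psi>e (t, y) = \<Psi>o (t, y)" if "\<bar>t\<bar> < pi/2" "norm y = 1" for t y
  proof -
    have "cos t *\<^sub>R (\<Psi> (t, y) - \<Psi>e (t, y)) = cos t *\<^sub>R \<Psi>o (t, y)"
      using a.rescaled[OF that] e.rescaled[OF that] o.rescaled[OF that] parts(3)[of \<phi> "conf (t, y)"]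
      by (simp add: algebra_simps)
    then show ?thesis using cos_pos_strip[OF that(1)] by simp
  qed
  have "\<Psi>o (t, y) = 0" if "\<bar>t\<bar> < pi/2" "norm y = 1" for t y
  proof (rule o.odd_dirichlet_zero_imp_zero[OF _ _ that(2,1)])
    show "\<Psi>o (- t, - y) = - \<Psi>o (t, y)" if "\<bar>t\<bar> < pi/2" "norm y = 1" for t y
      using o.parity[of "- 1", OF _ that] parts(2)[of \<phi>] by (simp add: antipodally_odd_def)
    fix y :: "real^4" assume y: "norm y = 1"
    have "((\<lambda>t. \<Psi> (t, y) - \<Psi>e (t, y)) \<longlongrightarrow> 0 - 0) (at_right (-pi/2))"
      by (intro tendsto_diff a.dirichlet_zero_tendsto e.dirichlet_zero_tendsto y zero
          even_boundary_data dS_solution_parts sol parts)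
    moreover have "\<forall>\<^sub>F t in at_right (-pi/2). \<Psi> (t, y) - \<Psi>e (t, y) = \<Psi>o (t, y)"
      by (rule eventually_mono[OF eventually_at_right_real[of "-pi/2" "pi/2"]])
        (auto intro!: split y simp: abs_less_iff)
    ultimately show "((\<lambda>t. \<Psi>o (t, y)) \<longlongrightarrow> 0) (at_right (-pi/2))"
      using Lim_transform_eventually by fastforce
  qed
  then have "odd_part \<phi> x = 0" if x: "x \<in> dS4" for x
    using o.rescaled by (auto intro: dS4_conf[OF x])
  then show ?thesis
    by (simp add: antipodally_even_def odd_part_def)
qed

text \<open>The same argument one time derivative higher: \<open>\<partial>\<^sub>t \<Psi>e\<close>
  has odd parity and zero Dirichlet data, hence vanishes. This leaves \<open>\<Psi>e\<close>
  constant in time.\<close>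

lemma neumann_zero_imp_odd:
  assumes sol: "dS_solution \<phi>" and zero: "\<And>\<omega>. norm \<omega> = 1 \<Longrightarrow> bd_pi_minus \<phi> \<omega> = 0"
  shows "antipodally_odd \<phi>"
proof -
  obtain \<Psi> V where "conformal_field \<Psi> V \<phi>"
    using dS_solution_conformal_field[OF sol] .
  then interpret a: conformal_field \<Psi> V \<phi> .
  obtain \<Psi>e Ve where "conformal_field \<Psi>e Ve (even_part \<phi>)"
    using dS_solution_conformal_field[OF dS_solution_parts(1)[OF sol]] .
  then interpret e: conformal_field \<Psi>e Ve "even_part \<phi>" .
  obtain \<Psi>o Vo where "conformal_field \<Psi>o Vo (odd_part \<phi>)"
    using dS_solution_conformal_field[OF dS_solution_parts(2)[OF sol]] .
  then interpret o: conformal_field \<Psi>o Vo "odd_part \<phi>" .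
  let ?J = "{-pi/2<..<pi/2}"
  have J: "\<bar>t\<bar> < pi/2" if "t \<in> ?J" for t
    using that unfolding greaterThanLessThan_iff by linarith
  have split: "\<Psi> (t, y) - \<Psi>o (t, y) = \<Psi>e (t, y)" if "\<bar>t\<bar> < pi/2" "norm y = 1" for t y
  proof -
    have "cos t *\<^sub>R (\<Psi> (t, y) - \<Psi>o (t, y)) = cos t *\<^sub>R \<Psi>e (t, y)"
      using a.rescaled[OF that] e.rescaled[OF that] o.rescaled[OF that] parts(3)[of \<phi> "conf (t, y)"]
      by (simp add: algebra_simps)
    then show ?thesis using cos_pos_strip[OF that(1)] by simp
  qed
  have split': "ddir (1, 0) \<Psi> (t, y) - ddir (1, 0) \<Psi>o (t, y) = ddir (1, 0) \<Psi>e (t, y)"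
    if t: "t \<in> ?J" and y: "norm y = 1" for t y
  proof -
    have "((\<lambda>s. \<Psi> (s, y) - \<Psi>o (s, y)) has_vector_derivative
      ddir (1, 0) \<Psi> (t, y) - ddir (1, 0) \<Psi>o (t, y)) (at t)"
      by (intro has_vector_derivative_diff a.has_time_derivative o.has_time_derivative J[OF t] y)
    then have "((\<lambda>s. \<Psi>e (s, y)) has_vector_derivative
      ddir (1, 0) \<Psi> (t, y) - ddir (1, 0) \<Psi>o (t, y)) (at t)"
      by (rule has_vector_derivative_transform_within_open[OF _ _ t]) (use split J y in auto)
    from vector_derivative_unique_at[OF this e.has_time_derivative[OF J[OF t] y]] show ?thesis .
  qed
  have even: "\<Psi>e (- t, - y) = 1 *\<^sub>R \<Psi>e (t, y)" if "\<bar>t\<bar> < pi/2" "norm y = 1" for t y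
    using e.parity[of 1, OF _ that] parts(1)[of \<phi>] by (simp add: antipodally_even_def)
  have dt0: "ddir (1, 0) \<Psi>e (t, y) = 0" if "\<bar>t\<bar> < pi/2" "norm y = 1" for t y
  proof (rule e.dt.odd_dirichlet_zero_imp_zero[OF _ _ that(2,1)])
    show "ddir (1, 0) \<Psi>e (- t, - y) = - ddir (1, 0) \<Psi>e (t, y)" if "\<bar>t\<bar> < pi/2" "norm y = 1" for t y
      using e.time_derivative_parity[OF even that] by simp
    fix y :: "real^4" assume y: "norm y = 1"
    have "((\<lambda>t. ddir (1, 0) \<Psi> (t, y) - ddir (1, 0) \<Psi>o (t, y)) \<longlongrightarrow> 0 - 0) (at_right (-pi/2))"
      by (intro tendsto_diff a.neumann_zero_tendsto o.odd_time_derivative_tendsto y zero parts)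
    moreover have "\<forall>\<^sub>F t in at_right (-pi/2). ddir (1, 0) \<Psi> (t, y) - ddir (1, 0) \<Psi>o (t, y) = ddir (1, 0) \<Psi>e (t, y)"
      by (rule eventually_mono[OF eventually_at_right_real[of "-pi/2" "pi/2"] split'[OF _ y]]) auto
    ultimately show "((\<lambda>t. ddir (1, 0) \<Psi>e (t, y)) \<longlongrightarrow> 0) (at_right (-pi/2))"
      using Lim_transform_eventually by fastforce
  qed
  \<comment> \<open>The constant is fixed by the zero Dirichlet data of the even part.\<close>
  have "\<Psi>e (t, y) = 0" if t: "t \<in> ?J" and y: "norm y = 1" for t y
  proof -
    have "((\<lambda>s. \<Psi>e (s, y)) has_vector_derivative 0) (at s within ?J)" if "s \<in> ?J" for s
      using e.has_time_derivative[OF J[OF that] y] dt0[OF J[OF that] y] has_vector_derivative_at_within by force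
    then obtain k where k: "\<And>s. s \<in> ?J \<Longrightarrow> \<Psi>e (s, y) = k"
      using has_vector_derivative_zero_constant[of ?J "\<lambda>s. \<Psi>e (s, y)"] by blast
    have "((\<lambda>s. \<Psi>e (s, y)) \<longlongrightarrow> 0) (at_right (-pi/2))"
      by (rule e.dirichlet_zero_tendsto[OF y even_boundary_data(2)[OF dS_solution_parts(1)[OF sol] parts(1) y]])
    moreover have "\<forall>\<^sub>F s in at_right (-pi/2). \<Psi>e (s, y) = k"
      by (rule eventually_mono[OF eventually_at_right_real[of "-pi/2" "pi/2"] k]) auto
    ultimately have "((\<lambda>s. k) \<longlongrightarrow> 0) (at_right (-pi/2))"
      by (rule Lim_transform_eventually)
    then have "k = 0"
      by (simp add: tendsto_const_iff)
    then show ?thesis using k t by simp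
  qed
  then have "even_part \<phi> x = 0" if x4: "x \<in> dS4" for x
  proof -
    obtain t y where x: "\<bar>t\<bar> < pi/2" "norm y = 1" "x = conf (t, y)"
      using dS4_conf[OF x4] .
    then have "t \<in> ?J" unfolding greaterThanLessThan_iff by linarith
    then show ?thesis
      using e.rescaled[OF x(1,2)] \<open>\<And>y t. t \<in> ?J \<Longrightarrow> norm y = 1 \<Longrightarrow> \<Psi>e (t, y) = 0\<close> x by simp
  qed
  moreover have "\<phi> (- x) = 2 * even_part \<phi> x - \<phi> x" for x
    by (simp add: even_part_def)
  ultimately show ?thesis
    by (simp add: antipodally_odd_def)
qed

theorem theorem1:
  shows
  "(\<forall>\<phi>. dS_solution \<phi> \<longrightarrow> (\<forall>\<omega>\<in>S3.
        (\<exists>L. (resc \<phi> \<omega> \<longlongrightarrow> L) (at_right 0)) \<and>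
        (\<exists>L. (resc \<phi> \<omega> \<longlongrightarrow> L) (at_left 0)) \<and>
        (\<exists>L. (dz_resc \<phi> \<omega> \<longlongrightarrow> L) (at_right 0)) \<and>
        (\<exists>L. (dz_resc \<phi> \<omega> \<longlongrightarrow> L) (at_left 0))))
   \<and> (\<forall>\<phi>. dS_solution \<phi> \<longrightarrow>
        (\<exists>\<phi>e \<phi>o. dS_solution \<phi>e \<and> antipodally_even \<phi>e \<and>
                 dS_solution \<phi>o \<and> antipodally_odd \<phi>o \<and>
                 (\<forall>x\<in>dS4. \<phi> x = \<phi>e x + \<phi>o x)))
   \<and> (\<forall>\<psi>. dS_solution \<psi> \<and> antipodally_even \<psi> \<and> antipodally_odd \<psi> \<longrightarrow>
        (\<forall>x\<in>dS4. \<psi> x = 0))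
   \<and> (\<forall>\<phi>. dS_solution \<phi> \<and> antipodally_even \<phi> \<longrightarrow>
        (\<forall>\<omega>\<in>S3. bd_phi_plus \<phi> \<omega> = 0 \<and> bd_phi_minus \<phi> \<omega> = 0))
   \<and> (\<forall>\<phi>. dS_solution \<phi> \<and> antipodally_odd \<phi> \<longrightarrow>
        (\<forall>\<omega>\<in>S3. bd_pi_plus \<phi> \<omega> = 0 \<and> bd_pi_minus \<phi> \<omega> = 0))
   \<and> (\<forall>\<phi>. dS_solution \<phi> \<and> (\<forall>\<omega>\<in>S3. bd_phi_minus \<phi> \<omega> = 0) \<longrightarrow> antipodally_even \<phi>)
   \<and> (\<forall>\<phi>. dS_solution \<phi> \<and> (\<forall>\<omega>\<in>S3. bd_pi_minus \<phi> \<omega> = 0) \<longrightarrow> antipodally_odd \<phi>)"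
proof (intro conjI allI impI ballI)
  fix \<phi> \<omega> assume sol: "dS_solution \<phi>" and "\<omega> \<in> S3"
  then have \<omega>: "norm \<omega> = 1" by (simp add: S3_def)
  obtain \<Psi> V where "conformal_field \<Psi> V \<phi>"
    using dS_solution_conformal_field[OF sol] .
  then interpret conformal_field \<Psi> V \<phi> .
  show "\<exists>L. (resc \<phi> \<omega> \<longlongrightarrow> L) (at_right 0)" "\<exists>L. (resc \<phi> \<omega> \<longlongrightarrow> L) (at_left 0)"
    "\<exists>L. (dz_resc \<phi> \<omega> \<longlongrightarrow> L) (at_right 0)" "\<exists>L. (dz_resc \<phi> \<omega> \<longlongrightarrow> L) (at_left 0)"
    by (rule boundary_limits_exist[OF \<omega>])+
next
  fix \<phi> assume "dS_solution \<phi>"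
  then show "\<exists>\<phi>e \<phi>o. dS_solution \<phi>e \<and> antipodally_even \<phi>e \<and> dS_solution \<phi>o \<and> antipodally_odd \<phi>o \<and>
      (\<forall>x\<in>dS4. \<phi> x = \<phi>e x + \<phi>o x)"
    using dS_solution_parts parts by blast
next
  fix \<psi> x assume "dS_solution \<psi> \<and> antipodally_even \<psi> \<and> antipodally_odd \<psi>" "x \<in> dS4"
  then have "\<psi> x = - \<psi> x"
    by (metis antipodally_even_def antipodally_odd_def)
  then show "\<psi> x = 0" by simp
qed (auto simp: S3_def intro: even_boundary_data odd_boundary_data dirichlet_zero_imp_even
    neumann_zero_imp_odd)

end
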